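(* Let $k$ be a field and $\Omega=\bigcup_{n\ge 1}\Omega_n$ a set of operation symbols, where the elements of $\Omega_n$ are $n$-ary. Every associative $\Omega$-algebra $A$ over $k$ can be embedded into a simple associative $\Omega$-algebra over $k$; that is, there exist a simple associative $\Omega$-algebra $\mathcal{A}$ and an injective homomorphism of associative $\Omega$-algebras $A\to\mathcal{A}$.
   Context: An associative $\Omega$-algebra over a field $k$ is an associative $k$-algebra $A$ (not required to have a unit) together with, for each $n\ge 1$ and each $\delta\in\Omega_n$, a $k$-multilinear map $\delta:A^n\to A$ (no further identities are imposed). Homomorphisms are $k$-algebra homomorphisms (not required to preserve units) commuting with all operations in $\Omega$. An ideal of an associative $\Omega$-algebra $A$ is a two-sided ideal $I$ of the algebra $A$ such that $\delta(a_1,\dots,a_n)\in I$ whenever $\delta\in\Omega_n$ and at least one $a_i\in I$. An associative $\Omega$-algebra is simple if its multiplication is not identically zero and its only ideals are $0$ and itself. *)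

theory Defs
  imports "HOL-Algebra.Algebra"
begin

text \<open>
  A signature is a family \<open>\<Omega> :: nat \<Rightarrow> 'o set\<close>, where \<open>\<Omega> n\<close> is the set of \<open>n\<close>-ary operation symbols;
  only the sets \<open>\<Omega> n\<close> with \<open>n \<ge> 1\<close> are ever used. An element of \<open>A\<^sup>n\<close> is a list of length \<open>n\<close>
  over the carrier of \<open>A\<close>.

  The algebras are not required to be unital: the field \<open>one\<close>, which the record type inherits
  from \<open>monoid\<close>, is left unconstrained and is never referred to.
\<close>

record ('k, 'a, 'o) omega_alg = "('k, 'a) module" +
  oper :: "'o \<Rightarrow> 'a list \<Rightarrow> 'a"

definition tuples :: "('a, 'm) partial_object_scheme \<Rightarrow> nat \<Rightarrow> 'a list set" where
  "tuples A n = {xs. length xs = n \<and> set xs \<subseteq> carrier A}"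

definition multilinear_op ::
  "('k, 'l) ring_scheme \<Rightarrow> ('k, 'a, 'm) module_scheme \<Rightarrow> nat \<Rightarrow> ('a list \<Rightarrow> 'a) \<Rightarrow> bool" where
  "multilinear_op K A n f \<longleftrightarrow>
     f \<in> tuples A n \<rightarrow> carrier A \<and>
     (\<forall>xs \<in> tuples A n. \<forall>i < n. \<forall>x \<in> carrier A. \<forall>y \<in> carrier A.
        f (xs[i := x \<oplus>\<^bsub>A\<^esub> y]) = f (xs[i := x]) \<oplus>\<^bsub>A\<^esub> f (xs[i := y])) \<and>
     (\<forall>xs \<in> tuples A n. \<forall>i < n. \<forall>c \<in> carrier K. \<forall>x \<in> carrier A.
        f (xs[i := c \<odot>\<^bsub>A\<^esub> x]) = c \<odot>\<^bsub>A\<^esub> f (xs[i := x]))"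

locale assoc_omega_algebra = K?: field K + module K A
  for K :: "('k, 'l) ring_scheme" (structure)
  and \<Omega> :: "nat \<Rightarrow> 'o set"
  and A :: "('k, 'a, 'o, 'm) omega_alg_scheme" (structure) +
  assumes mult_closed:
      "\<lbrakk>x \<in> carrier A; y \<in> carrier A\<rbrakk> \<Longrightarrow> x \<otimes>\<^bsub>A\<^esub> y \<in> carrier A"
    and mult_assoc:
      "\<lbrakk>x \<in> carrier A; y \<in> carrier A; z \<in> carrier A\<rbrakk> \<Longrightarrow>
         (x \<otimes>\<^bsub>A\<^esub> y) \<otimes>\<^bsub>A\<^esub> z = x \<otimes>\<^bsub>A\<^esub> (y \<otimes>\<^bsub>A\<^esub> z)"
    and distr_left:
      "\<lbrakk>x \<in> carrier A; y \<in> carrier A; z \<in> carrier A\<rbrakk> \<Longrightarrow>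
         (x \<oplus>\<^bsub>A\<^esub> y) \<otimes>\<^bsub>A\<^esub> z = x \<otimes>\<^bsub>A\<^esub> z \<oplus>\<^bsub>A\<^esub> y \<otimes>\<^bsub>A\<^esub> z"
    and distr_right:
      "\<lbrakk>x \<in> carrier A; y \<in> carrier A; z \<in> carrier A\<rbrakk> \<Longrightarrow>
         z \<otimes>\<^bsub>A\<^esub> (x \<oplus>\<^bsub>A\<^esub> y) = z \<otimes>\<^bsub>A\<^esub> x \<oplus>\<^bsub>A\<^esub> z \<otimes>\<^bsub>A\<^esub> y"
    and smult_mult_left:
      "\<lbrakk>c \<in> carrier K; x \<in> carrier A; y \<in> carrier A\<rbrakk> \<Longrightarrow>
         (c \<odot>\<^bsub>A\<^esub> x) \<otimes>\<^bsub>A\<^esub> y = c \<odot>\<^bsub>A\<^esub> (x \<otimes>\<^bsub>A\<^esub> y)"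
    and smult_mult_right:
      "\<lbrakk>c \<in> carrier K; x \<in> carrier A; y \<in> carrier A\<rbrakk> \<Longrightarrow>
         x \<otimes>\<^bsub>A\<^esub> (c \<odot>\<^bsub>A\<^esub> y) = c \<odot>\<^bsub>A\<^esub> (x \<otimes>\<^bsub>A\<^esub> y)"
    and oper_multilinear:
      "\<lbrakk>1 \<le> n; \<delta> \<in> \<Omega> n\<rbrakk> \<Longrightarrow> multilinear_op K A n (oper A \<delta>)"

definition omega_hom ::
  "('k, 'l) ring_scheme \<Rightarrow> (nat \<Rightarrow> 'o set) \<Rightarrow> ('k, 'a, 'o, 'm) omega_alg_scheme \<Rightarrow>
   ('k, 'b, 'o, 'n) omega_alg_scheme \<Rightarrow> ('a \<Rightarrow> 'b) set" where
  "omega_hom K \<Omega> A B =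
     {h. h \<in> carrier A \<rightarrow> carrier B \<and>
         (\<forall>x \<in> carrier A. \<forall>y \<in> carrier A. h (x \<oplus>\<^bsub>A\<^esub> y) = h x \<oplus>\<^bsub>B\<^esub> h y) \<and>
         (\<forall>c \<in> carrier K. \<forall>x \<in> carrier A. h (c \<odot>\<^bsub>A\<^esub> x) = c \<odot>\<^bsub>B\<^esub> h x) \<and>
         (\<forall>x \<in> carrier A. \<forall>y \<in> carrier A. h (x \<otimes>\<^bsub>A\<^esub> y) = h x \<otimes>\<^bsub>B\<^esub> h y) \<and>
         (\<forall>n \<ge> 1. \<forall>\<delta> \<in> \<Omega> n. \<forall>xs \<in> tuples A n. h (oper A \<delta> xs) = oper B \<delta> (map h xs))}"

text \<open>
  Since algebras need not have a unit, an ideal of the algebra has to be required explicitly to be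
  a \<open>K\<close>-subspace; this is the \<open>submodule\<close> condition.
\<close>

definition omega_ideal ::
  "('k, 'l) ring_scheme \<Rightarrow> (nat \<Rightarrow> 'o set) \<Rightarrow> ('k, 'a, 'o, 'm) omega_alg_scheme \<Rightarrow>
   'a set \<Rightarrow> bool" where
  "omega_ideal K \<Omega> A I \<longleftrightarrow>
     submodule I K A \<and>
     (\<forall>a \<in> I. \<forall>x \<in> carrier A. x \<otimes>\<^bsub>A\<^esub> a \<in> I \<and> a \<otimes>\<^bsub>A\<^esub> x \<in> I) \<and>
     (\<forall>n \<ge> 1. \<forall>\<delta> \<in> \<Omega> n. \<forall>xs \<in> tuples A n. set xs \<inter> I \<noteq> {} \<longrightarrow> oper A \<delta> xs \<in> I)"

definition simple_omega_algebra ::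
  "('k, 'l) ring_scheme \<Rightarrow> (nat \<Rightarrow> 'o set) \<Rightarrow> ('k, 'a, 'o, 'm) omega_alg_scheme \<Rightarrow> bool" where
  "simple_omega_algebra K \<Omega> A \<longleftrightarrow>
     assoc_omega_algebra K \<Omega> A \<and>
     (\<exists>x \<in> carrier A. \<exists>y \<in> carrier A. x \<otimes>\<^bsub>A\<^esub> y \<noteq> \<zero>\<^bsub>A\<^esub>) \<and>
     (\<forall>I. omega_ideal K \<Omega> A I \<longrightarrow> I = {\<zero>\<^bsub>A\<^esub>} \<or> I = carrier A)"

text \<open>
  HOL cannot quantify existentially over types, so the existence of some algebra has to be
  expressed by existence of one over a fixed type that is large enough: here, sets of
  words over the disjoint union of the types of elements, scalars, operation symbols and
  natural numbers. The carrier may be any subset of it.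
\<close>

type_synonym ('k, 'a, 'o) ambient = "('a + 'k + 'o + nat) list set"

end

theory Submission
  imports Defs
begin

text \<open>
  The operations of \<open>\<Omega>\<close> play no role in the construction: if \<open>A\<close> embeds as an associative algebra into
  a simple associative algebra \<open>B\<close>, then a linear retraction \<open>B \<rightarrow> A\<close> extends all operations of \<open>A\<close> to
  multilinear operations on \<open>B\<close>, and additional operations can only remove ideals.

  For the associative part, let \<open>W = K \<times> A\<close> be the unitization of \<open>A\<close>, let \<open>V\<close> be the space of finitely
  supported functions from an index set to \<open>W\<close>, and let \<open>A\<close> act on \<open>V\<close> pointwise. If the index set is
  infinite and large enough, then for every \<open>a \<noteq> 0\<close> there is an endomorphism \<open>y\<close> of \<open>V\<close> such that \<open>a y\<close> is
  injective; a left inverse \<open>x\<close> of \<open>a y\<close> gives \<open>x a y = 1\<close>. So no proper ideal of \<open>End V\<close> contains a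
  nonzero element of \<open>A\<close>, and \<open>A\<close> embeds into the quotient of \<open>End V\<close> by a maximal ideal.
\<close>

section \<open>Linear maps over a field\<close>

text \<open>Values outside the carrier are left free, so membership constrains a map on the carrier
  only; \<open>endo\<close> later normalises the remaining values to zero.\<close>

definition lin :: "('k, 'l) ring_scheme \<Rightarrow> ('k, 'a, 'm) module_scheme \<Rightarrow>
    ('k, 'b, 'n) module_scheme \<Rightarrow> ('a \<Rightarrow> 'b) set" where
  "lin K V W = {f. f \<in> carrier V \<rightarrow> carrier W \<and>
     (\<forall>x \<in> carrier V. \<forall>y \<in> carrier V. f (x \<oplus>\<^bsub>V\<^esub> y) = f x \<oplus>\<^bsub>W\<^esub> f y) \<and>
     (\<forall>c \<in> carrier K. \<forall>x \<in> carrier V. f (c \<odot>\<^bsub>V\<^esub> x) = c \<odot>\<^bsub>W\<^esub> f x)}"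

lemma lin_closed: "f \<in> lin K V W \<Longrightarrow> x \<in> carrier V \<Longrightarrow> f x \<in> carrier W"
  and lin_add: "f \<in> lin K V W \<Longrightarrow> x \<in> carrier V \<Longrightarrow> y \<in> carrier V \<Longrightarrow>
    f (x \<oplus>\<^bsub>V\<^esub> y) = f x \<oplus>\<^bsub>W\<^esub> f y"
  and lin_smult: "f \<in> lin K V W \<Longrightarrow> c \<in> carrier K \<Longrightarrow> x \<in> carrier V \<Longrightarrow>
    f (c \<odot>\<^bsub>V\<^esub> x) = c \<odot>\<^bsub>W\<^esub> f x"
  by (auto simp: lin_def)

lemma linI:
  assumes "\<And>x. x \<in> carrier V \<Longrightarrow> f x \<in> carrier W"
    and "\<And>x y. x \<in> carrier V \<Longrightarrow> y \<in> carrier V \<Longrightarrow> f (x \<oplus>\<^bsub>V\<^esub> y) = f x \<oplus>\<^bsub>W\<^esub> f y"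
    and "\<And>c x. c \<in> carrier K \<Longrightarrow> x \<in> carrier V \<Longrightarrow> f (c \<odot>\<^bsub>V\<^esub> x) = c \<odot>\<^bsub>W\<^esub> f x"
  shows "f \<in> lin K V W"
  using assms by (auto simp: lin_def)

lemma lin_comp: "f \<in> lin K U V \<Longrightarrow> g \<in> lin K V W \<Longrightarrow> g \<circ> f \<in> lin K U W"
  by (rule linI) (simp_all add: lin_closed lin_add lin_smult)

lemma lin_zero:
  assumes "module K V" "module K W" "f \<in> lin K V W"
  shows "f \<zero>\<^bsub>V\<^esub> = \<zero>\<^bsub>W\<^esub>"
proof -
  interpret V: module K V by fact
  interpret W: module K W by fact
  have "f (\<zero>\<^bsub>K\<^esub> \<odot>\<^bsub>V\<^esub> \<zero>\<^bsub>V\<^esub>) = \<zero>\<^bsub>K\<^esub> \<odot>\<^bsub>W\<^esub> f \<zero>\<^bsub>V\<^esub>"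
    using assms(3) by (intro lin_smult) auto
  thus ?thesis using lin_closed[OF assms(3)] by simp
qed

lemma lin_minus:
  assumes "module K V" "module K W" "f \<in> lin K V W" "x \<in> carrier V"
  shows "f (\<ominus>\<^bsub>V\<^esub> x) = \<ominus>\<^bsub>W\<^esub> f x"
proof -
  interpret V: module K V by fact
  interpret W: module K W by fact
  have "f (\<ominus>\<^bsub>V\<^esub> x) \<oplus>\<^bsub>W\<^esub> f x = \<zero>\<^bsub>W\<^esub>"
    using assms(4) lin_add[OF assms(3), of "\<ominus>\<^bsub>V\<^esub> x" x] lin_zero[OF assms(1-3)]
    by (simp add: V.M.l_neg)
  thus ?thesis using lin_closed[OF assms(3)] assms(4)
    by (metis V.M.a_inv_closed W.M.minus_equality)
qed

lemma lin_inj_onI: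
  assumes "module K V" "module K W" "f \<in> lin K V W"
    and ker: "\<And>x. x \<in> carrier V \<Longrightarrow> f x = \<zero>\<^bsub>W\<^esub> \<Longrightarrow> x = \<zero>\<^bsub>V\<^esub>"
  shows "inj_on f (carrier V)"
proof (rule inj_onI)
  interpret V: module K V by fact
  interpret W: module K W by fact
  fix x y assume xy: "x \<in> carrier V" "y \<in> carrier V" "f x = f y"
  have "f (x \<oplus>\<^bsub>V\<^esub> \<ominus>\<^bsub>V\<^esub> y) = \<zero>\<^bsub>W\<^esub>"
    using xy lin_add[OF assms(3)] lin_minus[OF assms(1-3)] lin_closed[OF assms(3)]
    by (simp add: W.M.r_neg)
  hence "x \<oplus>\<^bsub>V\<^esub> \<ominus>\<^bsub>V\<^esub> y = \<zero>\<^bsub>V\<^esub>" using ker xy by simp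
  thus "x = y" using xy
    by (metis V.M.a_inv_closed V.M.minus_equality V.M.minus_minus)
qed

text \<open>Uniqueness makes a pointwise choice linear: sums and multiples of chosen values satisfy
  \<open>P\<close> at the sum or multiple of the arguments, hence agree with the values chosen
  there. Both one-sided inverses below arise this way.\<close>

lemma lin_of_graph:
  assumes "module K W" "module K V"
    and ex: "\<And>w. w \<in> carrier W \<Longrightarrow> \<exists>v \<in> carrier V. P w v"
    and uniq: "\<And>w v v'. w \<in> carrier W \<Longrightarrow> v \<in> carrier V \<Longrightarrow> v' \<in> carrier V \<Longrightarrow>
      P w v \<Longrightarrow> P w v' \<Longrightarrow> v = v'"
    and add: "\<And>w v w' v'. w \<in> carrier W \<Longrightarrow> w' \<in> carrier W \<Longrightarrow> v \<in> carrier V \<Longrightarrow>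
      v' \<in> carrier V \<Longrightarrow> P w v \<Longrightarrow> P w' v' \<Longrightarrow> P (w \<oplus>\<^bsub>W\<^esub> w') (v \<oplus>\<^bsub>V\<^esub> v')"
    and smult: "\<And>c w v. c \<in> carrier K \<Longrightarrow> w \<in> carrier W \<Longrightarrow> v \<in> carrier V \<Longrightarrow> P w v \<Longrightarrow>
      P (c \<odot>\<^bsub>W\<^esub> w) (c \<odot>\<^bsub>V\<^esub> v)"
  shows "\<exists>g \<in> lin K W V. \<forall>w \<in> carrier W. P w (g w)"
proof -
  interpret W: module K W by fact
  interpret V: module K V by fact
  obtain g where g: "\<And>w. w \<in> carrier W \<Longrightarrow> g w \<in> carrier V \<and> P w (g w)"
    using bchoice[of "carrier W" "\<lambda>w v. v \<in> carrier V \<and> P w v"] ex by blast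
  have "g \<in> lin K W V"
  proof (rule linI)
    show "g w \<in> carrier V" if "w \<in> carrier W" for w using g that by blast
    show "g (w \<oplus>\<^bsub>W\<^esub> w') = g w \<oplus>\<^bsub>V\<^esub> g w'" if "w \<in> carrier W" "w' \<in> carrier W" for w w'
      by (rule uniq[of "w \<oplus>\<^bsub>W\<^esub> w'"]) (use that g add in auto)
    show "g (c \<odot>\<^bsub>W\<^esub> w) = c \<odot>\<^bsub>V\<^esub> g w" if "c \<in> carrier K" "w \<in> carrier W" for c w
      by (rule uniq[of "c \<odot>\<^bsub>W\<^esub> w"]) (use that g smult in auto)
  qed
  with g show ?thesis by blast
qed

section \<open>Zorn's lemma and complements of subspaces\<close>

text \<open>Zorn's lemma applies because unions of nonempty chains keep all three conditions. With
  \<open>T\<close> empty and \<open>U\<close> a subspace this yields complements; with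
  \<open>T\<close> the one-sided multiplications and \<open>U\<close> the scalars it yields maximal
  ideals.\<close>

lemma maximal_submodule_avoiding:
  assumes "module K V" and U: "\<zero>\<^bsub>V\<^esub> \<in> U" and T0: "\<And>t. t \<in> T \<Longrightarrow> t \<zero>\<^bsub>V\<^esub> = \<zero>\<^bsub>V\<^esub>"
  obtains N where "submodule N K V" "\<And>t x. t \<in> T \<Longrightarrow> x \<in> N \<Longrightarrow> t x \<in> N" "N \<inter> U = {\<zero>\<^bsub>V\<^esub>}"
    and "\<And>N'. submodule N' K V \<Longrightarrow> (\<And>t x. t \<in> T \<Longrightarrow> x \<in> N' \<Longrightarrow> t x \<in> N') \<Longrightarrow>
      N \<subseteq> N' \<Longrightarrow> N' \<inter> U = {\<zero>\<^bsub>V\<^esub>} \<Longrightarrow> N' = N"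
proof -
  interpret V: module K V by fact
  define F where "F = {N. submodule N K V \<and> (\<forall>t\<in>T. \<forall>x\<in>N. t x \<in> N) \<and> N \<inter> U = {\<zero>\<^bsub>V\<^esub>}}"
  have "{\<zero>\<^bsub>V\<^esub>} \<in> F"
    unfolding F_def using U T0 by (auto intro!: V.submoduleI)
  moreover have "\<Union>C \<in> F" if C: "C \<noteq> {}" "subset.chain F C" for C
  proof -
    have CF: "\<And>N. N \<in> C \<Longrightarrow> N \<in> F" and lin: "\<And>N N'. N \<in> C \<Longrightarrow> N' \<in> C \<Longrightarrow> N \<subseteq> N' \<or> N' \<subseteq> N"
      using C by (auto simp: subset_chain_def)
    have sub: "submodule N K V" if "N \<in> C" for N using CF[OF that] F_def by blast
    have zero: "\<zero>\<^bsub>V\<^esub> \<in> N" if "N \<in> C" for N using CF[OF that] F_def by blast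
    have "submodule (\<Union>C) K V"
    proof (rule V.submoduleI)
      show "\<Union>C \<subseteq> carrier V" using V.submoduleE(1)[OF sub] by blast
      show "\<zero>\<^bsub>V\<^esub> \<in> \<Union>C" using zero C(1) by blast
      show "\<ominus>\<^bsub>V\<^esub> a \<in> \<Union>C" if "a \<in> \<Union>C" for a using that V.submoduleE(3)[OF sub] by blast
      show "c \<odot>\<^bsub>V\<^esub> x \<in> \<Union>C" if "c \<in> carrier K" "x \<in> \<Union>C" for c x
        using that V.submoduleE(4)[OF sub] by blast
      show "a \<oplus>\<^bsub>V\<^esub> b \<in> \<Union>C" if ab: "a \<in> \<Union>C" "b \<in> \<Union>C" for a b
      proof -
        obtain N N' where N: "N \<in> C" "a \<in> N" "N' \<in> C" "b \<in> N'" using ab by blast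
        \<comment> \<open>Comparability of chain members puts both summands into one of
          them.\<close>
        have "\<exists>L \<in> C. a \<in> L \<and> b \<in> L" using N lin[OF N(1,3)] by blast
        then obtain L where "L \<in> C" "a \<in> L" "b \<in> L" by blast
        thus ?thesis using V.submoduleE(5)[OF sub] by blast
      qed
    qed
    thus ?thesis using CF C(1) unfolding F_def by blast
  qed
  ultimately obtain N where N: "N \<in> F" "\<And>L. L \<in> F \<Longrightarrow> N \<subseteq> L \<Longrightarrow> L = N"
    using subset_Zorn_nonempty[of F] by blast
  show thesis
  proof (rule that[of N])
    show "submodule N K V" "N \<inter> U = {\<zero>\<^bsub>V\<^esub>}" "\<And>t x. t \<in> T \<Longrightarrow> x \<in> N \<Longrightarrow> t x \<in> N"
      using N(1) by (auto simp: F_def)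
    show "N' = N" if "submodule N' K V" "\<And>t x. t \<in> T \<Longrightarrow> x \<in> N' \<Longrightarrow> t x \<in> N'" "N \<subseteq> N'"
      "N' \<inter> U = {\<zero>\<^bsub>V\<^esub>}" for N'
      by (rule N(2)) (use that in \<open>auto simp: F_def\<close>)
  qed
qed

lemma submodule_zero_mem:
  assumes "module K V" "submodule N K V" shows "\<zero>\<^bsub>V\<^esub> \<in> N"
  using subgroup.one_closed[OF submodule.axioms(1)[OF assms(2)]] by simp

lemma submodule_adjoin:
  assumes "module K V" and N: "submodule N K V" and v: "v \<in> carrier V"
  shows "submodule {n \<oplus>\<^bsub>V\<^esub> c \<odot>\<^bsub>V\<^esub> v | n c. n \<in> N \<and> c \<in> carrier K} K V" (is "submodule ?S K V")
proof -
  interpret V: module K V by fact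
  note NE = V.submoduleE[OF N]
  have NC: "n \<in> carrier V" if "n \<in> N" for n using that NE(1) by blast
  show ?thesis
  proof (rule V.submoduleI)
    show "?S \<subseteq> carrier V" using NC v by auto
    have "\<zero>\<^bsub>V\<^esub> = \<zero>\<^bsub>V\<^esub> \<oplus>\<^bsub>V\<^esub> \<zero>\<^bsub>K\<^esub> \<odot>\<^bsub>V\<^esub> v" using v by simp
    thus "\<zero>\<^bsub>V\<^esub> \<in> ?S" using submodule_zero_mem[OF assms(1) N] by blast
    show "\<ominus>\<^bsub>V\<^esub> a \<in> ?S" if "a \<in> ?S" for a
    proof -
      obtain n c where a: "a = n \<oplus>\<^bsub>V\<^esub> c \<odot>\<^bsub>V\<^esub> v" "n \<in> N" "c \<in> carrier K" using \<open>a \<in> ?S\<close> by blast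
      have "\<ominus>\<^bsub>V\<^esub> a = \<ominus>\<^bsub>V\<^esub> n \<oplus>\<^bsub>V\<^esub> (\<ominus>\<^bsub>K\<^esub> c) \<odot>\<^bsub>V\<^esub> v"
        using a NC v by (simp add: V.M.minus_add V.smult_l_minus)
      thus ?thesis using a NE(3) by blast
    qed
    show "a \<oplus>\<^bsub>V\<^esub> b \<in> ?S" if "a \<in> ?S" "b \<in> ?S" for a b
    proof -
      obtain n c where a: "a = n \<oplus>\<^bsub>V\<^esub> c \<odot>\<^bsub>V\<^esub> v" "n \<in> N" "c \<in> carrier K" using \<open>a \<in> ?S\<close> by blast
      obtain m d where b: "b = m \<oplus>\<^bsub>V\<^esub> d \<odot>\<^bsub>V\<^esub> v" "m \<in> N" "d \<in> carrier K" using \<open>b \<in> ?S\<close> by blast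
      have "a \<oplus>\<^bsub>V\<^esub> b = (n \<oplus>\<^bsub>V\<^esub> m) \<oplus>\<^bsub>V\<^esub> (c \<oplus>\<^bsub>K\<^esub> d) \<odot>\<^bsub>V\<^esub> v"
        using a b NC v by (simp add: V.smult_l_distr V.M.a_ac)
      thus ?thesis using a b NE(5) by blast
    qed
    show "d \<odot>\<^bsub>V\<^esub> a \<in> ?S" if d: "d \<in> carrier K" and "a \<in> ?S" for d a
    proof -
      obtain n c where a: "a = n \<oplus>\<^bsub>V\<^esub> c \<odot>\<^bsub>V\<^esub> v" "n \<in> N" "c \<in> carrier K" using \<open>a \<in> ?S\<close> by blast
      have "d \<odot>\<^bsub>V\<^esub> a = d \<odot>\<^bsub>V\<^esub> n \<oplus>\<^bsub>V\<^esub> (d \<otimes>\<^bsub>K\<^esub> c) \<odot>\<^bsub>V\<^esub> v"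
        using a NC v d by (simp add: V.smult_r_distr V.smult_assoc1)
      thus ?thesis using a d NE(4) by blast
    qed
  qed
qed

text \<open>Take \<open>C\<close> maximal among the submodules meeting \<open>U\<close> only in
  zero, and adjoin \<open>v\<close>. If \<open>C + K v\<close> still meets \<open>U\<close>
  trivially, maximality puts \<open>v\<close> in \<open>C\<close>; otherwise a nonzero common
  element can be solved for \<open>v\<close>, which is where invertible scalars enter.\<close>

lemma submodule_complement:
  assumes "field K" "module K V" and U: "submodule U K V"
  obtains C where "submodule C K V" "U \<inter> C = {\<zero>\<^bsub>V\<^esub>}"
    "\<And>v. v \<in> carrier V \<Longrightarrow> \<exists>u \<in> U. \<exists>c \<in> C. v = u \<oplus>\<^bsub>V\<^esub> c"
proof -
  interpret K: field K by fact
  interpret V: module K V by fact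
  have U0: "\<zero>\<^bsub>V\<^esub> \<in> U" using submodule_zero_mem assms by blast
  obtain C where C: "submodule C K V" "C \<inter> U = {\<zero>\<^bsub>V\<^esub>}"
    and max: "\<And>N'. submodule N' K V \<Longrightarrow> C \<subseteq> N' \<Longrightarrow> N' \<inter> U = {\<zero>\<^bsub>V\<^esub>} \<Longrightarrow> N' = C"
    by (rule maximal_submodule_avoiding[OF assms(2) U0, of "{}"]) auto
  note UE = V.submoduleE[OF U] and CE = V.submoduleE[OF C(1)]
  have "\<exists>u \<in> U. \<exists>c \<in> C. v = u \<oplus>\<^bsub>V\<^esub> c" if v: "v \<in> carrier V" for v
  proof -
    let ?S = "{n \<oplus>\<^bsub>V\<^esub> c \<odot>\<^bsub>V\<^esub> v | n c. n \<in> C \<and> c \<in> carrier K}"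
    have S: "submodule ?S K V" using submodule_adjoin[OF assms(2) C(1) v] .
    have C0: "\<zero>\<^bsub>V\<^esub> \<in> C" using C(2) by blast
    have "C \<subseteq> ?S"
    proof
      fix x assume x: "x \<in> C"
      hence "x = x \<oplus>\<^bsub>V\<^esub> \<zero>\<^bsub>K\<^esub> \<odot>\<^bsub>V\<^esub> v" using CE(1) v by auto
      thus "x \<in> ?S" using x by blast
    qed
    have "v = \<zero>\<^bsub>V\<^esub> \<oplus>\<^bsub>V\<^esub> \<one>\<^bsub>K\<^esub> \<odot>\<^bsub>V\<^esub> v" using v by simp
    hence "v \<in> ?S" using C0 by blast
    show ?thesis
    proof (cases "?S \<inter> U = {\<zero>\<^bsub>V\<^esub>}")
      case True
      hence "v \<in> C" using max[OF S \<open>C \<subseteq> ?S\<close>] \<open>v \<in> ?S\<close> by blast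
      moreover have "v = \<zero>\<^bsub>V\<^esub> \<oplus>\<^bsub>V\<^esub> v" using v by simp
      ultimately show ?thesis using U0 by blast
    next
      case False
      then obtain u where u: "u \<in> ?S" "u \<in> U" "u \<noteq> \<zero>\<^bsub>V\<^esub>"
        using submodule_zero_mem[OF assms(2) S] U0 by blast
      then obtain n c where nc: "u = n \<oplus>\<^bsub>V\<^esub> c \<odot>\<^bsub>V\<^esub> v" "n \<in> C" "c \<in> carrier K" by blast
      have carr: "n \<in> carrier V" "u \<in> carrier V" using nc u UE(1) CE(1) by auto
      \<comment> \<open>A vanishing coefficient would put the nonzero \<open>u\<close> into
        \<open>C \<inter> U\<close>.\<close>
      have c0: "c \<noteq> \<zero>\<^bsub>K\<^esub>"
      proof
        assume "c = \<zero>\<^bsub>K\<^esub>"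
        hence "u \<in> C" using nc v carr by simp
        thus False using u C(2) by blast
      qed
      have ic: "inv\<^bsub>K\<^esub> c \<in> carrier K" "inv\<^bsub>K\<^esub> c \<otimes>\<^bsub>K\<^esub> c = \<one>\<^bsub>K\<^esub>"
        using c0 nc(3) K.field_Units by auto
      \<comment> \<open>Solve \<open>u = n + c v\<close> for \<open>v\<close>: dividing by
        \<open>c\<close> keeps the two summands in \<open>U\<close> and \<open>C\<close>.\<close>
      have "c \<odot>\<^bsub>V\<^esub> v = u \<oplus>\<^bsub>V\<^esub> \<ominus>\<^bsub>V\<^esub> n"
        unfolding nc(1) using nc(3) v carr
        by (simp add: V.M.a_comm[of n] V.M.a_assoc V.M.r_neg)
      hence "inv\<^bsub>K\<^esub> c \<odot>\<^bsub>V\<^esub> (c \<odot>\<^bsub>V\<^esub> v) = inv\<^bsub>K\<^esub> c \<odot>\<^bsub>V\<^esub> u \<oplus>\<^bsub>V\<^esub> inv\<^bsub>K\<^esub> c \<odot>\<^bsub>V\<^esub> (\<ominus>\<^bsub>V\<^esub> n)"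
        using ic carr by (simp add: V.smult_r_distr)
      hence "v = inv\<^bsub>K\<^esub> c \<odot>\<^bsub>V\<^esub> u \<oplus>\<^bsub>V\<^esub> inv\<^bsub>K\<^esub> c \<odot>\<^bsub>V\<^esub> (\<ominus>\<^bsub>V\<^esub> n)"
        using ic v nc(3) V.smult_assoc1[OF ic(1) nc(3) v] by simp
      thus ?thesis using UE(4)[OF ic(1) u(2)] CE(4)[OF ic(1) CE(3)[OF nc(2)]] by blast
    qed
  qed
  with C show thesis by (intro that[of C]) auto
qed

section \<open>Images, kernels and one-sided inverses of linear maps\<close>

lemma lin_image_submodule:
  assumes "module K V" "module K W" "f \<in> lin K V W"
  shows "submodule (f ` carrier V) K W"
proof -
  interpret V: module K V by fact
  interpret W: module K W by fact
  show ?thesis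
  proof (rule W.submoduleI)
    show "\<zero>\<^bsub>W\<^esub> \<in> f ` carrier V" using lin_zero[OF assms] by force
  qed (auto simp: lin_closed[OF assms(3)] lin_minus[OF assms, symmetric]
      lin_add[OF assms(3), symmetric] lin_smult[OF assms(3), symmetric])
qed

lemma lin_kernel_submodule:
  assumes "module K V" "module K W" "f \<in> lin K V W"
  shows "submodule {x \<in> carrier V. f x = \<zero>\<^bsub>W\<^esub>} K V"
proof -
  interpret V: module K V by fact
  interpret W: module K W by fact
  show ?thesis
    by (rule V.submoduleI)
      (auto simp: lin_zero[OF assms] lin_minus[OF assms] lin_add[OF assms(3)] lin_smult[OF assms(3)])
qed

text \<open>Split \<open>W\<close> into the image of \<open>f\<close> and a complement
  \<open>C\<close>; the inverse sends \<open>f v \<oplus> c\<close> with \<open>c \<in> C\<close> to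
  \<open>v\<close>.\<close>

lemma lin_left_inverse:
  assumes "field K" "module K V" "module K W" and f: "f \<in> lin K V W" "inj_on f (carrier V)"
  shows "\<exists>g \<in> lin K W V. \<forall>v \<in> carrier V. g (f v) = v"
proof -
  interpret V: module K V by fact
  interpret W: module K W by fact
  obtain C where C: "submodule C K W" "f ` carrier V \<inter> C = {\<zero>\<^bsub>W\<^esub>}"
    and dec: "\<And>w. w \<in> carrier W \<Longrightarrow> \<exists>u \<in> f ` carrier V. \<exists>c \<in> C. w = u \<oplus>\<^bsub>W\<^esub> c"
    using submodule_complement[OF assms(1,3) lin_image_submodule[OF assms(2,3) f(1)]] by blast
  note CE = W.submoduleE[OF C(1)]
  have CW: "c \<in> carrier W" if "c \<in> C" for c using that CE(1) by blast
  have uniq: "v = v'"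
    if v: "v \<in> carrier V" "v' \<in> carrier V" "c \<in> C" "c' \<in> C" "f v \<oplus>\<^bsub>W\<^esub> c = f v' \<oplus>\<^bsub>W\<^esub> c'" for v v' c c'
  proof -
    have fc: "f v \<in> carrier W" "f v' \<in> carrier W" using v lin_closed[OF f(1)] by auto
    \<comment> \<open>Rearranging the assumed equality shows that \<open>f (v - v')\<close> equals
      \<open>c' - c\<close>, so it lies both in the image and in \<open>C\<close>.\<close>
    have "f (v \<oplus>\<^bsub>V\<^esub> \<ominus>\<^bsub>V\<^esub> v') = f v \<oplus>\<^bsub>W\<^esub> \<ominus>\<^bsub>W\<^esub> f v'"
      using v by (simp add: lin_add[OF f(1)] lin_minus[OF assms(2,3) f(1)])
    also have "\<dots> = (f v \<oplus>\<^bsub>W\<^esub> c) \<oplus>\<^bsub>W\<^esub> \<ominus>\<^bsub>W\<^esub> c \<oplus>\<^bsub>W\<^esub> \<ominus>\<^bsub>W\<^esub> f v'"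
      using fc v(3) CW by (simp add: W.M.a_assoc W.M.r_neg)
    also have "\<dots> = (f v' \<oplus>\<^bsub>W\<^esub> c') \<oplus>\<^bsub>W\<^esub> \<ominus>\<^bsub>W\<^esub> c \<oplus>\<^bsub>W\<^esub> \<ominus>\<^bsub>W\<^esub> f v'" using v(5) by simp
    also have "\<dots> = (f v' \<oplus>\<^bsub>W\<^esub> \<ominus>\<^bsub>W\<^esub> f v') \<oplus>\<^bsub>W\<^esub> (c' \<oplus>\<^bsub>W\<^esub> \<ominus>\<^bsub>W\<^esub> c)"
      using fc v(3,4) CW by (simp add: W.M.a_ac)
    also have "\<dots> = c' \<oplus>\<^bsub>W\<^esub> \<ominus>\<^bsub>W\<^esub> c"
      using fc v(3,4) CW by (simp add: W.M.r_neg)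
    finally have "f (v \<oplus>\<^bsub>V\<^esub> \<ominus>\<^bsub>V\<^esub> v') \<in> C" using v CE(3,5) by simp
    hence "f (v \<oplus>\<^bsub>V\<^esub> \<ominus>\<^bsub>V\<^esub> v') = f \<zero>\<^bsub>V\<^esub>" using C(2) v lin_zero[OF assms(2,3) f(1)] by auto
    hence "v \<oplus>\<^bsub>V\<^esub> \<ominus>\<^bsub>V\<^esub> v' = \<zero>\<^bsub>V\<^esub>" using f(2) v by (auto dest: inj_onD)
    thus ?thesis using v by (metis V.M.a_inv_closed V.M.minus_equality V.M.minus_minus)
  qed
  have "\<exists>g \<in> lin K W V. \<forall>w \<in> carrier W. \<exists>c \<in> C. w = f (g w) \<oplus>\<^bsub>W\<^esub> c"
  proof (rule lin_of_graph[OF assms(3,2)])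
    show "\<exists>v \<in> carrier V. \<exists>c \<in> C. w = f v \<oplus>\<^bsub>W\<^esub> c" if "w \<in> carrier W" for w using dec[OF that] by blast
    show "v = v'" if "v \<in> carrier V" "v' \<in> carrier V" "\<exists>c \<in> C. w = f v \<oplus>\<^bsub>W\<^esub> c"
      "\<exists>c \<in> C. w = f v' \<oplus>\<^bsub>W\<^esub> c" for w v v' using uniq that by blast
    show "\<exists>c\<in>C. w \<oplus>\<^bsub>W\<^esub> w' = f (v \<oplus>\<^bsub>V\<^esub> v') \<oplus>\<^bsub>W\<^esub> c"
      if v: "v \<in> carrier V" "v' \<in> carrier V"
        and w: "\<exists>c \<in> C. w = f v \<oplus>\<^bsub>W\<^esub> c" "\<exists>c \<in> C. w' = f v' \<oplus>\<^bsub>W\<^esub> c" for w v w' v'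
    proof -
      obtain c c' where c: "c \<in> C" "c' \<in> C" "w = f v \<oplus>\<^bsub>W\<^esub> c" "w' = f v' \<oplus>\<^bsub>W\<^esub> c'" using w by blast
      have "w \<oplus>\<^bsub>W\<^esub> w' = f (v \<oplus>\<^bsub>V\<^esub> v') \<oplus>\<^bsub>W\<^esub> (c \<oplus>\<^bsub>W\<^esub> c')"
        using c v CW lin_closed[OF f(1)] by (simp add: lin_add[OF f(1)] W.M.a_ac)
      thus ?thesis using c CE(5) by blast
    qed
    show "\<exists>c'\<in>C. d \<odot>\<^bsub>W\<^esub> w = f (d \<odot>\<^bsub>V\<^esub> v) \<oplus>\<^bsub>W\<^esub> c'"
      if d: "d \<in> carrier K" and v: "v \<in> carrier V" and w: "\<exists>c \<in> C. w = f v \<oplus>\<^bsub>W\<^esub> c" for d w v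
    proof -
      obtain c where c: "c \<in> C" "w = f v \<oplus>\<^bsub>W\<^esub> c" using w by blast
      have "d \<odot>\<^bsub>W\<^esub> w = f (d \<odot>\<^bsub>V\<^esub> v) \<oplus>\<^bsub>W\<^esub> (d \<odot>\<^bsub>W\<^esub> c)"
        using c v d CW lin_closed[OF f(1)] by (simp add: lin_smult[OF f(1)] W.smult_r_distr)
      thus ?thesis using c d CE(4) by blast
    qed
  qed
  then obtain g where g: "g \<in> lin K W V" "\<And>w. w \<in> carrier W \<Longrightarrow> \<exists>c \<in> C. w = f (g w) \<oplus>\<^bsub>W\<^esub> c" by blast
  have "g (f v) = v" if v: "v \<in> carrier V" for v
  proof -
    have fv: "f v \<in> carrier W" using lin_closed[OF f(1) v] .
    obtain c where "c \<in> C" "f v = f (g (f v)) \<oplus>\<^bsub>W\<^esub> c" using g(2)[OF fv] by blast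
    \<comment> \<open>The decomposition of \<open>f v\<close> given by \<open>g\<close> is compared
      with the obvious one, whose \<open>C\<close>-part is zero.\<close>
    moreover have "f v \<oplus>\<^bsub>W\<^esub> \<zero>\<^bsub>W\<^esub> = f v" "\<zero>\<^bsub>W\<^esub> \<in> C" using fv C(2) by auto
    ultimately show ?thesis using uniq[of "g (f v)" v c "\<zero>\<^bsub>W\<^esub>"] v lin_closed[OF g(1) fv] by simp
  qed
  with g(1) show ?thesis by blast
qed

text \<open>On a complement \<open>C\<close> of its kernel, \<open>f\<close> is a bijection onto
  \<open>W\<close>; \<open>g\<close> is the inverse of this restriction.\<close>

lemma lin_right_inverse:
  assumes "field K" "module K V" "module K W" and f: "f \<in> lin K V W" "f ` carrier V = carrier W"
  shows "\<exists>g \<in> lin K W V. \<forall>w \<in> carrier W. f (g w) = w"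
proof -
  interpret V: module K V by fact
  interpret W: module K W by fact
  let ?N = "{x \<in> carrier V. f x = \<zero>\<^bsub>W\<^esub>}"
  obtain C where C: "submodule C K V" "?N \<inter> C = {\<zero>\<^bsub>V\<^esub>}"
    and dec: "\<And>v. v \<in> carrier V \<Longrightarrow> \<exists>u \<in> ?N. \<exists>c \<in> C. v = u \<oplus>\<^bsub>V\<^esub> c"
    using submodule_complement[OF assms(1,2) lin_kernel_submodule[OF assms(2,3) f(1)]] by blast
  note CE = V.submoduleE[OF C(1)]
  have CV: "c \<in> carrier V" if "c \<in> C" for c using that CE(1) by blast
  have "\<exists>g \<in> lin K W V. \<forall>w \<in> carrier W. g w \<in> C \<and> f (g w) = w"
  proof (rule lin_of_graph[OF assms(3,2)])
    show "\<exists>v \<in> carrier V. v \<in> C \<and> f v = w" if w: "w \<in> carrier W" for w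
    proof -
      have "w \<in> f ` carrier V" using w f(2) by simp
      then obtain v where v: "v \<in> carrier V" "f v = w" by (elim imageE) simp
      \<comment> \<open>Discarding the kernel part of a preimage moves it into \<open>C\<close>
        without changing its image.\<close>
      obtain u c where uc: "u \<in> ?N" "c \<in> C" "v = u \<oplus>\<^bsub>V\<^esub> c" using dec[OF v(1)] by blast
      have "f v = f c" using uc CV lin_closed[OF f(1)] by (simp add: lin_add[OF f(1)])
      thus ?thesis using uc(2) v CV by auto
    qed
    show "v = v'" if v: "v \<in> C \<and> f v = w" "v' \<in> C \<and> f v' = w" for w v v'
    proof -
      have vV: "v \<in> carrier V" "v' \<in> carrier V" using v CV by auto
      have "f (v \<oplus>\<^bsub>V\<^esub> \<ominus>\<^bsub>V\<^esub> v') = f v \<oplus>\<^bsub>W\<^esub> \<ominus>\<^bsub>W\<^esub> f v'"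
        using vV by (simp add: lin_add[OF f(1)] lin_minus[OF assms(2,3) f(1)])
      hence "f (v \<oplus>\<^bsub>V\<^esub> \<ominus>\<^bsub>V\<^esub> v') = \<zero>\<^bsub>W\<^esub>"
        using v lin_closed[OF f(1) vV(2)] by (simp add: W.M.r_neg)
      moreover have "v \<oplus>\<^bsub>V\<^esub> \<ominus>\<^bsub>V\<^esub> v' \<in> C" using v by (simp add: CE(3,5))
      ultimately have "v \<oplus>\<^bsub>V\<^esub> \<ominus>\<^bsub>V\<^esub> v' = \<zero>\<^bsub>V\<^esub>" using C(2) CV by blast
      thus ?thesis using vV by (metis V.M.a_inv_closed V.M.minus_equality V.M.minus_minus)
    qed
  qed (simp_all add: lin_add[OF f(1)] lin_smult[OF f(1)] CE(4,5))
  thus ?thesis by blast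
qed

section \<open>Finitely supported functions and coordinates\<close>

text \<open>The field as a one-dimensional space over itself, in a record that has a scalar
  multiplication.\<close>

definition scalars :: "('k, 'l) ring_scheme \<Rightarrow> ('k, 'k) module" where
  "scalars K = \<lparr>carrier = carrier K, monoid.mult = monoid.mult K, one = \<one>\<^bsub>K\<^esub>,
     ring.zero = \<zero>\<^bsub>K\<^esub>, add = add K, smult = monoid.mult K\<rparr>"

lemma module_scalars: assumes "field K" shows "module K (scalars K)"
proof -
  interpret K: field K by fact
  show ?thesis
    by (intro moduleI abelian_groupI)
      (auto simp: scalars_def K.is_cring K.a_ac K.m_assoc K.l_distr K.r_distr
        intro: bexI[of _ "\<ominus>\<^bsub>K\<^esub> x" for x] K.l_neg)
qed

text \<open>The direct sum of copies of \<open>V\<close>, indexed by the whole type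
  \<open>'i\<close>.\<close>

definition fsfun :: "('k, 'v, 'm) module_scheme \<Rightarrow> ('k, 'i \<Rightarrow> 'v) module" where
  "fsfun V = \<lparr>carrier = {f. (\<forall>i. f i \<in> carrier V) \<and> finite {i. f i \<noteq> \<zero>\<^bsub>V\<^esub>}},
     monoid.mult = undefined, one = undefined, ring.zero = (\<lambda>_. \<zero>\<^bsub>V\<^esub>), add = (\<lambda>f g i. f i \<oplus>\<^bsub>V\<^esub> g i),
     smult = (\<lambda>c f i. c \<odot>\<^bsub>V\<^esub> f i)\<rparr>"

lemma fsfun_sel [simp]:
  "\<zero>\<^bsub>fsfun V\<^esub> = (\<lambda>_. \<zero>\<^bsub>V\<^esub>)"
  "f \<oplus>\<^bsub>fsfun V\<^esub> g = (\<lambda>i. f i \<oplus>\<^bsub>V\<^esub> g i)"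
  "c \<odot>\<^bsub>fsfun V\<^esub> f = (\<lambda>i. c \<odot>\<^bsub>V\<^esub> f i)"
  by (simp_all add: fsfun_def)

lemma fsfun_carrier:
  "f \<in> carrier (fsfun V) \<longleftrightarrow> (\<forall>i. f i \<in> carrier V) \<and> finite {i. f i \<noteq> \<zero>\<^bsub>V\<^esub>}"
  by (simp add: fsfun_def)

lemma fsfunI:
  assumes "\<And>i. f i \<in> carrier V" "finite S" "\<And>i. i \<notin> S \<Longrightarrow> f i = \<zero>\<^bsub>V\<^esub>"
  shows "f \<in> carrier (fsfun V)"
proof -
  have "{i. f i \<noteq> \<zero>\<^bsub>V\<^esub>} \<subseteq> S" using assms(3) by blast
  thus ?thesis using assms finite_subset by (auto simp: fsfun_carrier)
qed

lemma fsfun_app: "f \<in> carrier (fsfun V) \<Longrightarrow> f i \<in> carrier V"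
  by (simp add: fsfun_carrier)

lemma fsfun_add_closed:
  assumes "module K V" "f \<in> carrier (fsfun V)" "g \<in> carrier (fsfun V)"
  shows "(\<lambda>i. f i \<oplus>\<^bsub>V\<^esub> g i) \<in> carrier (fsfun V)"
proof -
  interpret V: module K V by fact
  show ?thesis
    by (rule fsfunI[where S = "{i. f i \<noteq> \<zero>\<^bsub>V\<^esub>} \<union> {i. g i \<noteq> \<zero>\<^bsub>V\<^esub>}"])
      (use assms in \<open>auto simp: fsfun_carrier\<close>)
qed

lemma fsfun_lin_closed:
  assumes "module K V" "module K W" "h \<in> lin K V W" "f \<in> carrier (fsfun V)"
  shows "(\<lambda>i. h (f i)) \<in> carrier (fsfun W)"
  by (rule fsfunI[where S = "{i. f i \<noteq> \<zero>\<^bsub>V\<^esub>}"])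
    (use assms lin_zero[OF assms(1-3)] in \<open>auto simp: fsfun_carrier lin_closed[OF assms(3)]\<close>)

lemma lin_smult_const:
  assumes "module K V" "c \<in> carrier K" shows "(\<lambda>x. c \<odot>\<^bsub>V\<^esub> x) \<in> lin K V V"
proof -
  interpret V: module K V by fact
  show ?thesis
    by (rule linI)
      (use assms(2) in \<open>auto simp: V.smult_r_distr V.smult_assoc1[symmetric] V.R.m_comm\<close>)
qed

lemma module_fsfun:
  fixes V :: "('k, 'v, 'm) module_scheme"
  assumes "module K V" shows "module K (fsfun V :: ('k, 'i \<Rightarrow> 'v) module)"
proof -
  interpret V: module K V by fact
  note app = fsfun_app[of _ V]
  have neg: "\<exists>g \<in> carrier (fsfun V). (\<lambda>i. f i \<oplus>\<^bsub>V\<^esub> g i) = (\<lambda>_. \<zero>\<^bsub>V\<^esub>)"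
    if f: "f \<in> carrier (fsfun V)" for f :: "'i \<Rightarrow> 'v"
  proof (rule bexI[of _ "\<lambda>i. \<ominus>\<^bsub>V\<^esub> f i"])
    show "(\<lambda>i. f i \<oplus>\<^bsub>V\<^esub> \<ominus>\<^bsub>V\<^esub> f i) = (\<lambda>_. \<zero>\<^bsub>V\<^esub>)" using app[OF f] by (simp add: V.M.r_neg)
    show "(\<lambda>i. \<ominus>\<^bsub>V\<^esub> f i) \<in> carrier (fsfun V)"
      by (rule fsfunI[where S = "{i. f i \<noteq> \<zero>\<^bsub>V\<^esub>}"]) (use f in \<open>auto simp: fsfun_carrier\<close>)
  qed
  show ?thesis
    by (intro moduleI abelian_groupI V.R.is_cring)
      (auto simp: app V.M.a_ac V.smult_l_distr V.smult_r_distr V.smult_assoc1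
        fsfun_add_closed[OF assms] fsfun_lin_closed[OF assms assms lin_smult_const[OF assms]] neg
        intro: fsfunI[where S = "{}"])
qed

definition single :: "('k, 'v, 'm) module_scheme \<Rightarrow> 'i \<Rightarrow> 'v \<Rightarrow> 'i \<Rightarrow> 'v" where
  "single V i v = (\<lambda>j. if j = i then v else \<zero>\<^bsub>V\<^esub>)"

lemma single_closed:
  assumes "module K V" "v \<in> carrier V" shows "single V i v \<in> carrier (fsfun V)"
proof -
  interpret V: module K V by fact
  show ?thesis
    by (rule fsfunI[where S = "{i}"]) (use assms(2) in \<open>auto simp: single_def\<close>)
qed

text \<open>A finitely supported function is a finite sum of functions supported at one index, so a
  linear map is determined by its values on those. The induction peels one index off the
  support.\<close>

lemma lin_fsfun_eqI:
  fixes V :: "('k, 'v, 'm) module_scheme" and \<phi> :: "'i \<Rightarrow> 'v"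
  assumes "module K V" "module K W" and f: "f \<in> lin K (fsfun V) W" and g: "g \<in> lin K (fsfun V) W"
    and eq: "\<And>i v. v \<in> carrier V \<Longrightarrow> f (single V i v) = g (single V i v)"
    and \<phi>: "\<phi> \<in> carrier (fsfun V)"
  shows "f \<phi> = g \<phi>"
proof -
  interpret V: module K V by fact
  have "\<forall>\<phi> :: 'i \<Rightarrow> 'v. \<phi> \<in> carrier (fsfun V) \<longrightarrow> {i. \<phi> i \<noteq> \<zero>\<^bsub>V\<^esub>} = S \<longrightarrow> f \<phi> = g \<phi>" if "finite S" for S
    using that
  proof (induction S)
    case empty
    show ?case
    proof (intro allI impI)
      fix \<phi> :: "'i \<Rightarrow> 'v" assume "{i. \<phi> i \<noteq> \<zero>\<^bsub>V\<^esub>} = {}"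
      hence "\<phi> = \<zero>\<^bsub>fsfun V\<^esub>" by auto
      thus "f \<phi> = g \<phi>"
        using lin_zero[OF module_fsfun[OF assms(1)] assms(2) f] lin_zero[OF module_fsfun[OF assms(1)] assms(2) g]
        by metis
    qed
  next
    case (insert i S)
    show ?case
    proof (intro allI impI)
      fix \<phi> :: "'i \<Rightarrow> 'v" assume \<phi>: "\<phi> \<in> carrier (fsfun V)" "{i. \<phi> i \<noteq> \<zero>\<^bsub>V\<^esub>} = insert i S"
      \<comment> \<open>Erasing the entry of \<open>\<phi>\<close> at \<open>i\<close> leaves a
        function with support exactly \<open>S\<close>, to which the induction hypothesis
        applies.\<close>
      let ?\<psi> = "\<lambda>j. if j = i then \<zero>\<^bsub>V\<^esub> else \<phi> j"
      have \<psi>: "?\<psi> \<in> carrier (fsfun V)"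
        by (rule fsfunI[where S = S]) (use \<phi> insert.hyps in \<open>auto simp: fsfun_carrier\<close>)
      have supp: "{j. ?\<psi> j \<noteq> \<zero>\<^bsub>V\<^esub>} = S" using \<phi>(2) insert.hyps(2) by auto
      have si: "single V i (\<phi> i) \<in> carrier (fsfun V)" using single_closed[OF assms(1)] fsfun_app[OF \<phi>(1)] .
      have split: "\<phi> = single V i (\<phi> i) \<oplus>\<^bsub>fsfun V\<^esub> ?\<psi>"
        using fsfun_app[OF \<phi>(1)] by (auto simp: single_def)
      have "f (single V i (\<phi> i) \<oplus>\<^bsub>fsfun V\<^esub> ?\<psi>) = g (single V i (\<phi> i) \<oplus>\<^bsub>fsfun V\<^esub> ?\<psi>)"
        unfolding lin_add[OF f si \<psi>] lin_add[OF g si \<psi>]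
        using eq[OF fsfun_app[OF \<phi>(1)]] insert.IH \<psi> supp by simp
      thus "f \<phi> = g \<phi>" using split by metis
    qed
  qed
  thus ?thesis using \<phi> by (auto simp: fsfun_carrier)
qed

section \<open>Coordinates of vectors\<close>

text \<open>A section of the canonical surjection from the free module on the set \<open>W\<close> onto \<open>W\<close>; it plays the
  role of coordinates with respect to a basis.\<close>

lemma free_coordinates:
  fixes W :: "('k, 'w, 'm) module_scheme"
  assumes "field K" "module K W"
  obtains c :: "'w \<Rightarrow> 'w \<Rightarrow> 'k" where "c \<in> lin K W (fsfun (scalars K))" "inj_on c (carrier W)"
proof -
  interpret K: field K by fact
  interpret W: module K W by fact
  let ?F = "fsfun (scalars K) :: ('k, 'w \<Rightarrow> 'k) module"
  have F: "module K ?F" using module_fsfun[OF module_scalars[OF assms(1)]] .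
  interpret F: module K ?F by fact
  have Fc: "\<phi> \<in> carrier ?F \<longleftrightarrow> (\<forall>i. \<phi> i \<in> carrier K) \<and> finite {i. \<phi> i \<noteq> \<zero>\<^bsub>K\<^esub>}" for \<phi>
    by (simp add: fsfun_carrier scalars_def)
  \<comment> \<open>Elements of \<open>?F\<close> are functions on the whole type \<open>'w\<close>,
    but only their values on the carrier of \<open>W\<close> enter the evaluation \<open>ev\<close>,
    the canonical surjection.\<close>
  define supp where "supp = (\<lambda>\<phi>. {w \<in> carrier W. \<phi> w \<noteq> \<zero>\<^bsub>K\<^esub>})"
  define ev where "ev = (\<lambda>\<phi>. finsum W (\<lambda>w. \<phi> w \<odot>\<^bsub>W\<^esub> w) (supp \<phi>))"
  have fin: "finite (supp \<phi>)" "supp \<phi> \<subseteq> carrier W" if "\<phi> \<in> carrier ?F" for \<phi>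
    using that by (auto simp: supp_def Fc intro: rev_finite_subset)
  have term_closed: "(\<lambda>w. \<phi> w \<odot>\<^bsub>W\<^esub> w) \<in> S \<rightarrow> carrier W" if "\<phi> \<in> carrier ?F" "S \<subseteq> carrier W" for \<phi> S
    using that by (auto simp: Fc)
  \<comment> \<open>Enlarging the summation set adds only zero terms, so functions with different
    supports can be evaluated over a common set.\<close>
  have ev_eq: "ev \<phi> = finsum W (\<lambda>w. \<phi> w \<odot>\<^bsub>W\<^esub> w) S"
    if "\<phi> \<in> carrier ?F" "finite S" "supp \<phi> \<subseteq> S" "S \<subseteq> carrier W" for \<phi> S
    unfolding ev_def
    by (rule W.M.add.finprod_mono_neutral_cong_left)
      (use that term_closed in \<open>auto simp: supp_def\<close>)
  have ev: "ev \<in> lin K ?F W"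
  proof (rule linI)
    show "ev \<phi> \<in> carrier W" if "\<phi> \<in> carrier ?F" for \<phi>
      unfolding ev_def using term_closed[OF that fin(2)[OF that]] by (rule W.M.finsum_closed)
  next
    fix \<phi> \<psi> assume H: "\<phi> \<in> carrier ?F" "\<psi> \<in> carrier ?F"
    let ?S = "supp \<phi> \<union> supp \<psi>"
    have S: "finite ?S" "?S \<subseteq> carrier W" using fin H by auto
    have HK: "\<phi> w \<in> carrier K" "\<psi> w \<in> carrier K" for w using H by (auto simp: Fc)
    have S': "supp (\<phi> \<oplus>\<^bsub>?F\<^esub> \<psi>) \<subseteq> ?S" by (auto simp: supp_def scalars_def)
    have "ev (\<phi> \<oplus>\<^bsub>?F\<^esub> \<psi>) = finsum W (\<lambda>w. (\<phi> \<oplus>\<^bsub>?F\<^esub> \<psi>) w \<odot>\<^bsub>W\<^esub> w) ?S"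
      using H S S' by (intro ev_eq F.M.a_closed)
    also have "\<dots> = finsum W (\<lambda>w. \<phi> w \<odot>\<^bsub>W\<^esub> w \<oplus>\<^bsub>W\<^esub> \<psi> w \<odot>\<^bsub>W\<^esub> w) ?S"
      by (rule W.M.finsum_cong') (use HK S in \<open>auto simp: scalars_def W.smult_l_distr\<close>)
    also have "\<dots> = ev \<phi> \<oplus>\<^bsub>W\<^esub> ev \<psi>"
      using ev_eq[OF H(1) S(1)] ev_eq[OF H(2) S(1)] S(2) term_closed H
      by (simp add: W.M.finsum_addf)
    finally show "ev (\<phi> \<oplus>\<^bsub>?F\<^esub> \<psi>) = ev \<phi> \<oplus>\<^bsub>W\<^esub> ev \<psi>" .
  next
    fix d \<phi> assume d: "d \<in> carrier K" and \<phi>: "\<phi> \<in> carrier ?F"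
    have \<phi>K: "\<phi> w \<in> carrier K" for w using \<phi> by (auto simp: Fc)
    have "ev (d \<odot>\<^bsub>?F\<^esub> \<phi>) = finsum W (\<lambda>w. (d \<odot>\<^bsub>?F\<^esub> \<phi>) w \<odot>\<^bsub>W\<^esub> w) (supp \<phi>)"
      using fin[OF \<phi>] d \<phi> by (intro ev_eq F.smult_closed) (auto simp: supp_def scalars_def)
    also have "\<dots> = finsum W (\<lambda>w. d \<odot>\<^bsub>W\<^esub> (\<phi> w \<odot>\<^bsub>W\<^esub> w)) (supp \<phi>)"
      by (rule W.M.finsum_cong')
        (use \<phi>K d fin[OF \<phi>] in \<open>auto simp: scalars_def W.smult_assoc1\<close>)
    also have "\<dots> = d \<odot>\<^bsub>W\<^esub> ev \<phi>"
      unfolding ev_def using W.finsum_smult_ldistr[OF fin(1)[OF \<phi>] d term_closed[OF \<phi> fin(2)[OF \<phi>]]] ..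
    finally show "ev (d \<odot>\<^bsub>?F\<^esub> \<phi>) = d \<odot>\<^bsub>W\<^esub> ev \<phi>" .
  qed
  \<comment> \<open>Evaluating the indicator of \<open>w\<close> returns \<open>w\<close>, which
    gives surjectivity.\<close>
  have ev1: "ev (single (scalars K) w \<one>\<^bsub>K\<^esub>) = w" if w: "w \<in> carrier W" for w
  proof -
    have "single (scalars K) w \<one>\<^bsub>K\<^esub> \<in> carrier ?F"
      by (rule single_closed[OF module_scalars[OF assms(1)]]) (simp add: scalars_def)
    moreover have "supp (single (scalars K) w \<one>\<^bsub>K\<^esub>) \<subseteq> {w}"
      by (auto simp: supp_def single_def scalars_def)
    ultimately have "ev (single (scalars K) w \<one>\<^bsub>K\<^esub>) =
        finsum W (\<lambda>v. single (scalars K) w \<one>\<^bsub>K\<^esub> v \<odot>\<^bsub>W\<^esub> v) {w}"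
      using w by (intro ev_eq) auto
    thus ?thesis using w by (simp add: single_def W.M.finsum_insert W.M.finsum_empty)
  qed
  have surj: "ev ` carrier ?F = carrier W"
  proof
    show "ev ` carrier ?F \<subseteq> carrier W" using lin_closed[OF ev] by auto
    show "carrier W \<subseteq> ev ` carrier ?F"
    proof
      fix w assume w: "w \<in> carrier W"
      have "single (scalars K) w \<one>\<^bsub>K\<^esub> \<in> carrier ?F"
        by (rule single_closed[OF module_scalars[OF assms(1)]]) (simp add: scalars_def)
      thus "w \<in> ev ` carrier ?F" using ev1[OF w] by (metis imageI)
    qed
  qed
  obtain c where c: "c \<in> lin K W ?F" "\<forall>w \<in> carrier W. ev (c w) = w"
    using lin_right_inverse[OF assms(1) F assms(2) ev surj] by auto
  have "inj_on c (carrier W)" using c(2) by (metis inj_onI)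
  with c(1) show thesis by (rule that)
qed

section \<open>Endomorphism algebras\<close>

text \<open>Fixing the value zero outside the carrier makes equality of endomorphisms equality of
  functions; accordingly the unit is the identity cut off to zero.\<close>

definition endo :: "('k, 'l) ring_scheme \<Rightarrow> ('k, 'v, 'm) module_scheme \<Rightarrow> ('k, 'v \<Rightarrow> 'v, 'o) omega_alg" where
  "endo K V = \<lparr>carrier = {f \<in> lin K V V. \<forall>x. x \<notin> carrier V \<longrightarrow> f x = \<zero>\<^bsub>V\<^esub>},
     monoid.mult = (\<circ>), one = (\<lambda>x. if x \<in> carrier V then x else \<zero>\<^bsub>V\<^esub>),
     ring.zero = (\<lambda>_. \<zero>\<^bsub>V\<^esub>), add = (\<lambda>f g x. f x \<oplus>\<^bsub>V\<^esub> g x), smult = (\<lambda>c f x. c \<odot>\<^bsub>V\<^esub> f x),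
     oper = undefined\<rparr>"

lemma endo_sel [simp]:
  "f \<otimes>\<^bsub>endo K V\<^esub> g = f \<circ> g"
  "\<one>\<^bsub>endo K V\<^esub> = (\<lambda>x. if x \<in> carrier V then x else \<zero>\<^bsub>V\<^esub>)"
  "\<zero>\<^bsub>endo K V\<^esub> = (\<lambda>_. \<zero>\<^bsub>V\<^esub>)"
  "f \<oplus>\<^bsub>endo K V\<^esub> g = (\<lambda>x. f x \<oplus>\<^bsub>V\<^esub> g x)"
  "c \<odot>\<^bsub>endo K V\<^esub> f = (\<lambda>x. c \<odot>\<^bsub>V\<^esub> f x)"
  by (simp_all add: endo_def)

lemma endo_carrier:
  "f \<in> carrier (endo K V) \<longleftrightarrow> f \<in> lin K V V \<and> (\<forall>x. x \<notin> carrier V \<longrightarrow> f x = \<zero>\<^bsub>V\<^esub>)"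
  by (simp add: endo_def)

lemma endo_closed:
  assumes "module K V" "f \<in> carrier (endo K V)" shows "f x \<in> carrier V"
proof -
  interpret V: module K V by fact
  show ?thesis using assms(2) by (cases "x \<in> carrier V") (auto simp: endo_carrier lin_closed)
qed

definition extend_zero :: "('k, 'v, 'm) module_scheme \<Rightarrow> ('v \<Rightarrow> 'v) \<Rightarrow> 'v \<Rightarrow> 'v" where
  "extend_zero V f = (\<lambda>x. if x \<in> carrier V then f x else \<zero>\<^bsub>V\<^esub>)"

lemma extend_zero_endo:
  assumes "module K V" "f \<in> lin K V V" shows "extend_zero V f \<in> carrier (endo K V)"
proof -
  interpret V: module K V by fact
  show ?thesis using assms(2) by (auto simp: endo_carrier lin_def extend_zero_def Pi_def)
qed

lemma endo_algebra:
  assumes "field K" "module K V"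
  shows "assoc_omega_algebra K (\<lambda>_. {}) (endo K V :: ('k, 'v \<Rightarrow> 'v, 'o) omega_alg)" (is "assoc_omega_algebra _ _ ?E")
proof -
  interpret K: field K by fact
  interpret V: module K V by fact
  note cl = endo_closed[OF assms(2)]
  have Eadd: "f (x \<oplus>\<^bsub>V\<^esub> y) = f x \<oplus>\<^bsub>V\<^esub> f y"
    if "f \<in> carrier ?E" "x \<in> carrier V" "y \<in> carrier V" for f x y
    using that by (auto simp: endo_carrier lin_add)
  have Esmult: "f (c \<odot>\<^bsub>V\<^esub> x) = c \<odot>\<^bsub>V\<^esub> f x"
    if "f \<in> carrier ?E" "c \<in> carrier K" "x \<in> carrier V" for f x c
    using that by (auto simp: endo_carrier lin_smult)
  have E0: "f x = \<zero>\<^bsub>V\<^esub>" if "f \<in> carrier ?E" "x \<notin> carrier V" for f x using that by (simp add: endo_carrier)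
  have EI: "f \<in> carrier ?E"
    if "\<And>x. x \<in> carrier V \<Longrightarrow> f x \<in> carrier V" "\<And>x. x \<notin> carrier V \<Longrightarrow> f x = \<zero>\<^bsub>V\<^esub>"
      "\<And>x y. x \<in> carrier V \<Longrightarrow> y \<in> carrier V \<Longrightarrow> f (x \<oplus>\<^bsub>V\<^esub> y) = f x \<oplus>\<^bsub>V\<^esub> f y"
      "\<And>c x. c \<in> carrier K \<Longrightarrow> x \<in> carrier V \<Longrightarrow> f (c \<odot>\<^bsub>V\<^esub> x) = c \<odot>\<^bsub>V\<^esub> f x" for f
    using that by (auto simp: endo_carrier intro!: linI)
  \<comment> \<open>Needed for composites: outside the carrier the inner map gives zero, which the
    outer map must send to zero.\<close>
  have Ezero: "f \<zero>\<^bsub>V\<^esub> = \<zero>\<^bsub>V\<^esub>" if "f \<in> carrier ?E" for f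
    using that lin_zero[OF assms(2,2)] by (auto simp: endo_carrier)
  have add_cl: "(\<lambda>x. f x \<oplus>\<^bsub>V\<^esub> g x) \<in> carrier ?E" if "f \<in> carrier ?E" "g \<in> carrier ?E" for f g
    by (rule EI) (use that in \<open>simp_all add: cl Eadd Esmult E0 V.M.a_ac V.smult_r_distr\<close>)
  have smult_cl: "(\<lambda>x. c \<odot>\<^bsub>V\<^esub> f x) \<in> carrier ?E" if "c \<in> carrier K" "f \<in> carrier ?E" for c f
    by (rule EI)
      (use that in \<open>simp_all add: cl Eadd Esmult E0 V.smult_r_distr V.smult_assoc1[symmetric] K.m_comm\<close>)
  \<comment> \<open>The negative is the multiple by minus one, so closure under scalars supplies
    it.\<close>
  have neg: "\<exists>g \<in> carrier ?E. (\<lambda>x. g x \<oplus>\<^bsub>V\<^esub> f x) = (\<lambda>_. \<zero>\<^bsub>V\<^esub>)" if "f \<in> carrier ?E" for f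
    by (rule bexI[OF _ smult_cl[of "\<ominus>\<^bsub>K\<^esub> \<one>\<^bsub>K\<^esub>", OF _ that]])
      (use cl[OF that] in \<open>simp_all add: V.smult_l_minus V.M.l_neg\<close>)
  have zero_cl: "(\<lambda>_. \<zero>\<^bsub>V\<^esub>) \<in> carrier ?E" by (rule EI) simp_all
  have "abelian_group ?E"
    using neg by (intro abelian_groupI) (simp_all add: add_cl zero_cl V.M.a_ac cl)
  hence mod: "module K ?E"
    by (intro moduleI K.is_cring)
      (simp_all add: smult_cl cl V.smult_l_distr V.smult_r_distr V.smult_assoc1)
  have comp_cl: "f \<circ> g \<in> carrier ?E" if "f \<in> carrier ?E" "g \<in> carrier ?E" for f g
    by (rule EI) (use that in \<open>simp_all add: cl Eadd Esmult E0 Ezero\<close>)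
  show ?thesis
    unfolding assoc_omega_algebra_def assoc_omega_algebra_axioms_def
    using assms(1) mod comp_cl by (simp add: o_assoc fun_eq_iff cl Eadd Esmult)
qed

text \<open>An endomorphism is determined by its matrix entries, so it can be recorded as a set of
  quadruples.\<close>

lemma endo_encoding:
  fixes V :: "('k, 'v, 'm) module_scheme" and code :: "'i \<times> 'v \<times> 'i \<times> 'v \<Rightarrow> 'w"
  assumes "module K V" "inj code"
  shows "\<exists>enc :: (('i \<Rightarrow> 'v) \<Rightarrow> 'i \<Rightarrow> 'v) \<Rightarrow> 'w set.
    inj_on enc (carrier (endo K (fsfun V) :: ('k, _, 'o) omega_alg))"
proof (intro exI inj_onI)
  \<comment> \<open>Each code also contains the position \<open>(i, v, j)\<close>, so injectivity of
    \<open>code\<close> lets the entry at that position be read off the set.\<close>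
  define enc where "enc = (\<lambda>T. {code (i, v, j, T (single V i v) j) | i v j. v \<in> carrier V})"
  fix T T' assume T: "T \<in> carrier (endo K (fsfun V) :: ('k, _, 'o) omega_alg)"
    "T' \<in> carrier (endo K (fsfun V) :: ('k, _, 'o) omega_alg)" and "enc T = enc T'"
  have "T (single V i v) j = T' (single V i v) j" if "v \<in> carrier V" for i v j
  proof -
    have "code (i, v, j, T (single V i v) j) \<in> enc T" using that by (auto simp: enc_def)
    hence "code (i, v, j, T (single V i v) j) \<in> enc T'" using \<open>enc T = enc T'\<close> by simp
    thus ?thesis using assms(2) by (auto simp: enc_def inj_eq)
  qed
  hence eq: "T (single V i v) = T' (single V i v)" if "v \<in> carrier V" for i v using that by blast
  show "T = T'"
  proof
    fix \<phi>
    show "T \<phi> = T' \<phi>"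
    proof (cases "\<phi> \<in> carrier (fsfun V)")
      case True
      show ?thesis
        by (rule lin_fsfun_eqI[OF assms(1) module_fsfun[OF assms(1)] _ _ _ True])
          (use T eq in \<open>simp_all add: endo_carrier\<close>)
    qed (use T in \<open>simp add: endo_carrier\<close>)
  qed
qed

section \<open>The diagonal action of the algebra\<close>

text \<open>Every nonzero element of \<open>A\<close> generates the unit ideal of the endomorphism algebra: the map
  \<open>j\<close> below spreads the coordinates of all the values of a function over fresh indices, as multiples
  of \<open>u\<close>, so that the action of \<open>a\<close> composed with \<open>j\<close> is injective and has a left inverse.\<close>

lemma diagonal_action:
  fixes K :: "('k, 'l) ring_scheme" and W :: "('k, 'w, 'm) module_scheme"
    and A :: "('k, 'a, 'n) module_scheme" and e :: "'i \<Rightarrow> 'w \<Rightarrow> 'i"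
  assumes "field K" "module K W" "module K A"
    and act: "\<And>a. a \<in> carrier A \<Longrightarrow> act a \<in> lin K W W"
    and act_add: "\<And>a b w. a \<in> carrier A \<Longrightarrow> b \<in> carrier A \<Longrightarrow> w \<in> carrier W \<Longrightarrow>
      act (a \<oplus>\<^bsub>A\<^esub> b) w = act a w \<oplus>\<^bsub>W\<^esub> act b w"
    and act_smult: "\<And>c a w. c \<in> carrier K \<Longrightarrow> a \<in> carrier A \<Longrightarrow> w \<in> carrier W \<Longrightarrow>
      act (c \<odot>\<^bsub>A\<^esub> a) w = c \<odot>\<^bsub>W\<^esub> act a w"
    and act_mult: "\<And>a b w. a \<in> carrier A \<Longrightarrow> b \<in> carrier A \<Longrightarrow> w \<in> carrier W \<Longrightarrow>
      act (a \<otimes>\<^bsub>A\<^esub> b) w = act a (act b w)"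
    and u: "u \<in> carrier W" "\<And>a. a \<in> carrier A \<Longrightarrow> act a u = \<zero>\<^bsub>W\<^esub> \<Longrightarrow> a = \<zero>\<^bsub>A\<^esub>"
    and e: "\<And>i w i' w'. e i w = e i' w' \<Longrightarrow> i = i' \<and> w = w'"
  defines "E \<equiv> endo K (fsfun W) :: ('k, ('i \<Rightarrow> 'w) \<Rightarrow> 'i \<Rightarrow> 'w, 'o) omega_alg"
  shows "\<exists>\<iota> \<in> lin K A E.
    (\<forall>a \<in> carrier A. \<forall>b \<in> carrier A. \<iota> (a \<otimes>\<^bsub>A\<^esub> b) = \<iota> a \<otimes>\<^bsub>E\<^esub> \<iota> b) \<and>
    (\<forall>a \<in> carrier A. a \<noteq> \<zero>\<^bsub>A\<^esub> \<longrightarrow>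
      (\<exists>x \<in> carrier E. \<exists>y \<in> carrier E. x \<otimes>\<^bsub>E\<^esub> (\<iota> a \<otimes>\<^bsub>E\<^esub> y) = \<one>\<^bsub>E\<^esub>))"
proof -
  interpret K: field K by fact
  interpret W: module K W by fact
  interpret A: module K A by fact
  let ?V = "fsfun W :: ('k, 'i \<Rightarrow> 'w) module"
  have V: "module K ?V" by (rule module_fsfun[OF assms(2)])
  interpret V: module K ?V by fact
  define D where "D = (\<lambda>a (\<phi> :: 'i \<Rightarrow> 'w) i. act a (\<phi> i))"
  define \<iota> where "\<iota> = (\<lambda>a. extend_zero ?V (D a))"
  have D: "D a \<in> lin K ?V ?V" if a: "a \<in> carrier A" for a
    by (rule linI)
      (simp_all add: D_def fsfun_lin_closed[OF assms(2,2) act[OF a]] fsfun_app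
        lin_add[OF act[OF a]] lin_smult[OF act[OF a]])
  have \<iota>E: "\<iota> a \<in> carrier E" if "a \<in> carrier A" for a
    unfolding \<iota>_def E_def by (rule extend_zero_endo[OF V D[OF that]])
  have \<iota>_lin: "\<iota> \<in> lin K A E"
    by (rule linI)
      (auto simp: \<iota>E, auto simp: \<iota>_def E_def extend_zero_def D_def act_add act_smult fsfun_app fun_eq_iff)
  have \<iota>_mult: "\<iota> (a \<otimes>\<^bsub>A\<^esub> b) = \<iota> a \<otimes>\<^bsub>E\<^esub> \<iota> b" if a: "a \<in> carrier A" "b \<in> carrier A" for a b
  proof
    fix \<phi> :: "'i \<Rightarrow> 'w"
    \<comment> \<open>Covers arguments outside the carrier, where \<open>\<iota> b\<close> gives the
      zero function.\<close>
    have "\<iota> a (\<lambda>_. \<zero>\<^bsub>W\<^esub>) = (\<lambda>_. \<zero>\<^bsub>W\<^esub>)"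
      using lin_zero[OF assms(2,2) act[OF a(1)]] by (simp add: \<iota>_def extend_zero_def D_def)
    thus "\<iota> (a \<otimes>\<^bsub>A\<^esub> b) \<phi> = (\<iota> a \<otimes>\<^bsub>E\<^esub> \<iota> b) \<phi>"
      using lin_closed[OF D[OF a(2)], of \<phi>] a
      by (auto simp: E_def \<iota>_def extend_zero_def D_def act_mult fsfun_app)
  qed
  obtain c :: "'w \<Rightarrow> 'w \<Rightarrow> 'k" where c: "c \<in> lin K W (fsfun (scalars K))" "inj_on c (carrier W)"
    using free_coordinates[OF assms(1,2)] .
  have cK: "c w v \<in> carrier K" if "w \<in> carrier W" for w v
    using fsfun_app[OF lin_closed[OF c(1) that]] by (simp add: scalars_def)
  have c_fin: "finite {v. c w v \<noteq> \<zero>\<^bsub>K\<^esub>}" if "w \<in> carrier W" for w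
    using lin_closed[OF c(1) that] by (simp add: fsfun_carrier scalars_def)
  have c0: "c \<zero>\<^bsub>W\<^esub> v = \<zero>\<^bsub>K\<^esub>" for v
    using lin_zero[OF assms(2) module_fsfun[OF module_scalars[OF assms(1)]] c(1)] by (simp add: scalars_def)
  \<comment> \<open>The entry at the fresh index \<open>e i v\<close> is the coordinate
    \<open>v\<close> of \<open>\<phi> i\<close>, times \<open>u\<close>; injectivity of
    \<open>e\<close> lets \<open>THE\<close> recover \<open>i\<close> and \<open>v\<close>. Indices
    outside the range of \<open>e\<close> get zero.\<close>
  define j where "j = (\<lambda>(\<phi> :: 'i \<Rightarrow> 'w) k. if \<exists>i v. k = e i v
      then c (\<phi> (THE i. \<exists>v. k = e i v)) (THE v. \<exists>i. k = e i v) \<odot>\<^bsub>W\<^esub> u else \<zero>\<^bsub>W\<^esub>)"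
  have j_e: "j \<phi> (e i v) = c (\<phi> i) v \<odot>\<^bsub>W\<^esub> u" for \<phi> i v
  proof -
    have "(THE i'. \<exists>v'. e i v = e i' v') = i" "(THE v'. \<exists>i'. e i v = e i' v') = v"
      by (rule the_equality; use e in blast)+
    thus ?thesis unfolding j_def by auto
  qed
  have j_not_e: "j \<phi> k = \<zero>\<^bsub>W\<^esub>" if "\<nexists>i v. k = e i v" for \<phi> k
    using that by (simp add: j_def)
  have j_lin: "j \<in> lin K ?V ?V"
  proof (rule linI)
    fix \<phi> assume \<phi>: "\<phi> \<in> carrier ?V"
    \<comment> \<open>A finite union of finite sets: finitely many entries of \<open>\<phi>\<close>
      are nonzero, and each has finitely many nonzero coordinates.\<close>
    let ?S = "\<Union>i \<in> {i. \<phi> i \<noteq> \<zero>\<^bsub>W\<^esub>}. e i ` {v. c (\<phi> i) v \<noteq> \<zero>\<^bsub>K\<^esub>}"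
    show "j \<phi> \<in> carrier ?V"
    proof (rule fsfunI[where S = ?S])
      show "j \<phi> k \<in> carrier W" for k
        by (cases "\<exists>i v. k = e i v") (use j_e j_not_e cK fsfun_app[OF \<phi>] u in auto)
      show "finite ?S" using \<phi> c_fin by (auto simp: fsfun_carrier)
      show "j \<phi> k = \<zero>\<^bsub>W\<^esub>" if "k \<notin> ?S" for k
      proof (cases "\<exists>i v. k = e i v")
        case True
        then obtain i v where "k = e i v" by blast
        moreover from this have "c (\<phi> i) v = \<zero>\<^bsub>K\<^esub>" using that c0 by (cases "\<phi> i = \<zero>\<^bsub>W\<^esub>") auto
        ultimately show ?thesis using j_e u by simp
      qed (use j_not_e in blast)
    qed
  next
    fix \<phi> \<psi> assume H: "\<phi> \<in> carrier ?V" "\<psi> \<in> carrier ?V"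
    show "j (\<phi> \<oplus>\<^bsub>?V\<^esub> \<psi>) = j \<phi> \<oplus>\<^bsub>?V\<^esub> j \<psi>"
    proof
      fix k
      show "j (\<phi> \<oplus>\<^bsub>?V\<^esub> \<psi>) k = (j \<phi> \<oplus>\<^bsub>?V\<^esub> j \<psi>) k"
      proof (cases "\<exists>i v. k = e i v")
        case True
        then obtain i v where "k = e i v" by blast
        thus ?thesis using fsfun_app[OF H(1)] fsfun_app[OF H(2)] cK u
          by (simp add: j_e lin_add[OF c(1)] W.smult_l_distr) (simp add: scalars_def W.smult_l_distr)
      qed (use j_not_e in simp)
    qed
  next
    fix d \<phi> assume d: "d \<in> carrier K" and \<phi>: "\<phi> \<in> carrier ?V"
    show "j (d \<odot>\<^bsub>?V\<^esub> \<phi>) = d \<odot>\<^bsub>?V\<^esub> j \<phi>"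
    proof
      fix k
      show "j (d \<odot>\<^bsub>?V\<^esub> \<phi>) k = (d \<odot>\<^bsub>?V\<^esub> j \<phi>) k"
      proof (cases "\<exists>i v. k = e i v")
        case True
        then obtain i v where "k = e i v" by blast
        thus ?thesis using fsfun_app[OF \<phi>] cK u d
          by (simp add: j_e lin_smult[OF c(1)]) (simp add: scalars_def W.smult_assoc1)
      qed (use j_not_e d in simp)
    qed
  qed
  have key: "\<exists>x \<in> carrier E. \<exists>y \<in> carrier E. x \<otimes>\<^bsub>E\<^esub> (\<iota> a \<otimes>\<^bsub>E\<^esub> y) = \<one>\<^bsub>E\<^esub>"
    if a: "a \<in> carrier A" "a \<noteq> \<zero>\<^bsub>A\<^esub>" for a
  proof -
    have f: "D a \<circ> j \<in> lin K ?V ?V" by (rule lin_comp[OF j_lin D[OF a(1)]])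
    have "inj_on (D a \<circ> j) (carrier ?V)"
    proof (rule lin_inj_onI[OF V V f])
      fix \<phi> assume \<phi>: "\<phi> \<in> carrier ?V" and z: "(D a \<circ> j) \<phi> = \<zero>\<^bsub>?V\<^esub>"
      \<comment> \<open>The entry of the image at \<open>e i v\<close> is the coordinate times
        \<open>act a u\<close>, and \<open>act a u\<close> is nonzero because \<open>a\<close> is;
        so every coordinate of \<open>\<phi> i\<close> vanishes.\<close>
      have "c (\<phi> i) v = \<zero>\<^bsub>K\<^esub>" for i v
      proof (rule ccontr)
        assume nz: "c (\<phi> i) v \<noteq> \<zero>\<^bsub>K\<^esub>"
        let ?t = "c (\<phi> i) v"
        have t: "?t \<in> carrier K" "inv\<^bsub>K\<^esub> ?t \<in> carrier K" "inv\<^bsub>K\<^esub> ?t \<otimes>\<^bsub>K\<^esub> ?t = \<one>\<^bsub>K\<^esub>"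
          using nz cK[OF fsfun_app[OF \<phi>], of i v] K.field_Units by auto
        have au: "act a u \<in> carrier W" using lin_closed[OF act[OF a(1)] u(1)] .
        have "?t \<odot>\<^bsub>W\<^esub> act a u = (D a \<circ> j) \<phi> (e i v)"
          using t u by (simp add: D_def j_e lin_smult[OF act[OF a(1)]])
        also have "\<dots> = \<zero>\<^bsub>W\<^esub>" using z by simp
        finally have "inv\<^bsub>K\<^esub> ?t \<odot>\<^bsub>W\<^esub> (?t \<odot>\<^bsub>W\<^esub> act a u) = \<zero>\<^bsub>W\<^esub>" using t by simp
        hence "act a u = \<zero>\<^bsub>W\<^esub>" using t au by (simp add: W.smult_assoc1[symmetric])
        thus False using u(2) a by blast
      qed
      hence "c (\<phi> i) = c \<zero>\<^bsub>W\<^esub>" for i using c0 by auto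
      thus "\<phi> = \<zero>\<^bsub>?V\<^esub>" using c(2) fsfun_app[OF \<phi>] by (auto dest: inj_onD)
    qed
    then obtain x where x: "x \<in> lin K ?V ?V" "\<And>\<phi>. \<phi> \<in> carrier ?V \<Longrightarrow> x ((D a \<circ> j) \<phi>) = \<phi>"
      using lin_left_inverse[OF assms(1) V V f] by blast
    have x0: "x (\<lambda>_. \<zero>\<^bsub>W\<^esub>) = (\<lambda>_. \<zero>\<^bsub>W\<^esub>)" using lin_zero[OF V V x(1)] by simp
    have D0: "D a (\<lambda>_. \<zero>\<^bsub>W\<^esub>) = (\<lambda>_. \<zero>\<^bsub>W\<^esub>)" using lin_zero[OF V V D[OF a(1)]] by simp
    \<comment> \<open>On the carrier this is the left inverse property; elsewhere \<open>D0\<close>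
      and \<open>x0\<close> carry the zero value through, matching the cut-off unit.\<close>
    have "(extend_zero ?V x \<otimes>\<^bsub>E\<^esub> (\<iota> a \<otimes>\<^bsub>E\<^esub> extend_zero ?V j)) \<phi> = \<one>\<^bsub>E\<^esub> \<phi>" for \<phi>
      using x(2)[of \<phi>] lin_closed[OF j_lin, of \<phi>] lin_closed[OF f, of \<phi>]
      by (auto simp: E_def \<iota>_def extend_zero_def D0 x0)
    hence "extend_zero ?V x \<otimes>\<^bsub>E\<^esub> (\<iota> a \<otimes>\<^bsub>E\<^esub> extend_zero ?V j) = \<one>\<^bsub>E\<^esub>" by (rule ext)
    moreover have "extend_zero ?V x \<in> carrier E" "extend_zero ?V j \<in> carrier E"
      unfolding E_def by (rule extend_zero_endo[OF V x(1)], rule extend_zero_endo[OF V j_lin])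
    ultimately show ?thesis by blast
  qed
  show ?thesis using \<iota>_lin \<iota>_mult key by blast
qed

section \<open>Quotients by maximal ideals\<close>

text \<open>The quotient of \<open>R\<close> is carried by the values of \<open>q\<close> rather
  than by cosets, which leaves its element type free; \<open>d\<close> picks representatives. The
  operations \<open>op\<close> are supplied from outside, since they do not come from
  \<open>R\<close>.\<close>

definition image_alg :: "('k, 'r, 'n, 'm) omega_alg_scheme \<Rightarrow> ('r \<Rightarrow> 'b) \<Rightarrow> ('o \<Rightarrow> 'b list \<Rightarrow> 'b) \<Rightarrow>
    ('k, 'b, 'o) omega_alg" where
  "image_alg R q op = (let d = inv_into (carrier R) q in
    \<lparr>carrier = q ` carrier R, monoid.mult = (\<lambda>x y. q (d x \<otimes>\<^bsub>R\<^esub> d y)), one = undefined,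
     ring.zero = q \<zero>\<^bsub>R\<^esub>, add = (\<lambda>x y. q (d x \<oplus>\<^bsub>R\<^esub> d y)), smult = (\<lambda>c x. q (c \<odot>\<^bsub>R\<^esub> d x)),
     oper = op\<rparr>)"

locale algebra_quotient = assoc_omega_algebra K "\<lambda>_. {}" R
  for K :: "('k, 'l) ring_scheme" and R :: "('k, 'r, 'n, 'm) omega_alg_scheme" +
  fixes M :: "'r set" and q :: "'r \<Rightarrow> 'b"
  assumes ideal: "omega_ideal K (\<lambda>_. {}) R M"
    and q_eq_iff: "x \<in> carrier R \<Longrightarrow> y \<in> carrier R \<Longrightarrow> q x = q y \<longleftrightarrow> x \<oplus>\<^bsub>R\<^esub> \<ominus>\<^bsub>R\<^esub> y \<in> M"
begin

lemma module_R: "module K R" by unfold_locales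

lemma submodule_M: "submodule M K R" using ideal by (simp add: omega_ideal_def)

text \<open>The difference \<open>x - y\<close> lies in \<open>M\<close>, and \<open>f\<close> maps
  it to \<open>f x - f y\<close>, again in \<open>M\<close>. Multiplication from either side and
  scaling are all instances.\<close>

lemma q_cong_lin:
  assumes f: "f \<in> lin K R R" "\<And>m. m \<in> M \<Longrightarrow> f m \<in> M"
    and x: "x \<in> carrier R" "y \<in> carrier R" "q x = q y"
  shows "q (f x) = q (f y)"
proof -
  have "f (x \<oplus>\<^bsub>R\<^esub> \<ominus>\<^bsub>R\<^esub> y) \<in> M" using f(2) x q_eq_iff by blast
  thus ?thesis using x lin_closed[OF f(1)]
    by (simp add: q_eq_iff lin_add[OF f(1)] lin_minus[OF module_R module_R f(1)])
qed

abbreviation d :: "'b \<Rightarrow> 'r" where "d \<equiv> inv_into (carrier R) q"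

lemma d_q: "x \<in> carrier R \<Longrightarrow> d (q x) \<in> carrier R" "x \<in> carrier R \<Longrightarrow> q (d (q x)) = q x"
  by (auto intro: inv_into_into f_inv_into_f)

lemma lin_mult_left: "x \<in> carrier R \<Longrightarrow> (\<lambda>y. x \<otimes>\<^bsub>R\<^esub> y) \<in> lin K R R"
  and lin_mult_right: "x \<in> carrier R \<Longrightarrow> (\<lambda>y. y \<otimes>\<^bsub>R\<^esub> x) \<in> lin K R R"
  by (rule linI; simp add: mult_closed distr_left distr_right smult_mult_left smult_mult_right)+

lemma ideal_mult:
  "x \<in> carrier R \<Longrightarrow> m \<in> M \<Longrightarrow> x \<otimes>\<^bsub>R\<^esub> m \<in> M" "x \<in> carrier R \<Longrightarrow> m \<in> M \<Longrightarrow> m \<otimes>\<^bsub>R\<^esub> x \<in> M"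
  using ideal by (auto simp: omega_ideal_def)

text \<open>Representatives are exchanged one factor at a time, the linear map being multiplication
  by the other factor.\<close>

lemma q_mult:
  assumes "x \<in> carrier R" "y \<in> carrier R"
  shows "q (d (q x) \<otimes>\<^bsub>R\<^esub> d (q y)) = q (x \<otimes>\<^bsub>R\<^esub> y)"
proof -
  have "q (d (q x) \<otimes>\<^bsub>R\<^esub> d (q y)) = q (d (q x) \<otimes>\<^bsub>R\<^esub> y)"
    by (rule q_cong_lin[OF lin_mult_left]) (use assms d_q ideal_mult in auto)
  also have "\<dots> = q (x \<otimes>\<^bsub>R\<^esub> y)"
    by (rule q_cong_lin[OF lin_mult_right]) (use assms d_q ideal_mult in auto)
  finally show ?thesis .
qed

lemma q_smult:
  assumes "c \<in> carrier K" "x \<in> carrier R"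
  shows "q (c \<odot>\<^bsub>R\<^esub> d (q x)) = q (c \<odot>\<^bsub>R\<^esub> x)"
  by (rule q_cong_lin[OF lin_smult_const[OF module_R assms(1)]])
    (use assms d_q submoduleE(4)[OF submodule_M] in auto)

lemma q_add:
  assumes "x \<in> carrier R" "y \<in> carrier R"
  shows "q (d (q x) \<oplus>\<^bsub>R\<^esub> d (q y)) = q (x \<oplus>\<^bsub>R\<^esub> y)"
proof -
  let ?x = "d (q x)" and ?y = "d (q y)"
  have c: "?x \<in> carrier R" "?y \<in> carrier R" using assms d_q by auto
  have "(?x \<oplus>\<^bsub>R\<^esub> \<ominus>\<^bsub>R\<^esub> x) \<oplus>\<^bsub>R\<^esub> (?y \<oplus>\<^bsub>R\<^esub> \<ominus>\<^bsub>R\<^esub> y) \<in> M"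
    by (rule submoduleE(5)[OF submodule_M]; use assms c d_q q_eq_iff in blast)
  moreover have "(?x \<oplus>\<^bsub>R\<^esub> \<ominus>\<^bsub>R\<^esub> x) \<oplus>\<^bsub>R\<^esub> (?y \<oplus>\<^bsub>R\<^esub> \<ominus>\<^bsub>R\<^esub> y) = (?x \<oplus>\<^bsub>R\<^esub> ?y) \<oplus>\<^bsub>R\<^esub> \<ominus>\<^bsub>R\<^esub> (x \<oplus>\<^bsub>R\<^esub> y)"
    using assms c by (simp add: M.minus_add M.a_ac)
  ultimately show ?thesis using assms c q_eq_iff by simp
qed

lemma image_alg_sel:
  "carrier (image_alg R q op) = q ` carrier R"
  "\<zero>\<^bsub>image_alg R q op\<^esub> = q \<zero>\<^bsub>R\<^esub>"
  "oper (image_alg R q op) = op"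
  "x \<in> carrier R \<Longrightarrow> y \<in> carrier R \<Longrightarrow> q x \<otimes>\<^bsub>image_alg R q op\<^esub> q y = q (x \<otimes>\<^bsub>R\<^esub> y)"
  "x \<in> carrier R \<Longrightarrow> y \<in> carrier R \<Longrightarrow> q x \<oplus>\<^bsub>image_alg R q op\<^esub> q y = q (x \<oplus>\<^bsub>R\<^esub> y)"
  "c \<in> carrier K \<Longrightarrow> x \<in> carrier R \<Longrightarrow> c \<odot>\<^bsub>image_alg R q op\<^esub> q x = q (c \<odot>\<^bsub>R\<^esub> x)"
  by (simp_all add: image_alg_def Let_def q_mult q_add q_smult)

lemma module_image_alg: "module K (image_alg R q op)"
proof (intro moduleI abelian_groupI K.is_cring)
  fix x assume "x \<in> carrier (image_alg R q op)"
  then obtain r where r: "r \<in> carrier R" "x = q r" by (auto simp: image_alg_sel)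
  show "\<exists>y \<in> carrier (image_alg R q op). y \<oplus>\<^bsub>image_alg R q op\<^esub> x = \<zero>\<^bsub>image_alg R q op\<^esub>"
    by (rule bexI[of _ "q (\<ominus>\<^bsub>R\<^esub> r)"]) (use r in \<open>auto simp: image_alg_sel M.l_neg\<close>)
qed (auto simp: image_alg_sel M.a_ac smult_l_distr smult_r_distr smult_assoc1)

lemma q_lin: "q \<in> lin K R (image_alg R q op)"
  by (rule linI) (simp_all add: image_alg_sel)

lemma image_alg_algebra:
  assumes "\<And>n \<delta>. 1 \<le> n \<Longrightarrow> \<delta> \<in> \<Omega> n \<Longrightarrow> multilinear_op K (image_alg R q op) n (op \<delta>)"
  shows "assoc_omega_algebra K \<Omega> (image_alg R q op)"
proof (intro assoc_omega_algebra.intro assoc_omega_algebra_axioms.intro)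
  show "field K" by unfold_locales
  show "module K (image_alg R q op)" by (rule module_image_alg)
qed (use assms in \<open>auto simp: image_alg_sel mult_closed mult_assoc distr_left distr_right
    smult_mult_left smult_mult_right\<close>)

text \<open>An ideal \<open>I\<close> of the quotient pulls back to an ideal \<open>N\<close> of
  \<open>R\<close> containing \<open>M\<close>. If \<open>N\<close> contains \<open>e\<close>, then
  \<open>I\<close> is everything; if not, maximality gives \<open>N = M\<close>, and
  \<open>I\<close> is zero.\<close>

lemma image_alg_simple:
  assumes alg: "assoc_omega_algebra K \<Omega> (image_alg R q op)"
    and one: "e \<in> carrier R" "\<And>x. x \<in> carrier R \<Longrightarrow> x \<otimes>\<^bsub>R\<^esub> e = x" "e \<notin> M"
    and max: "\<And>N. omega_ideal K (\<lambda>_. {}) R N \<Longrightarrow> M \<subseteq> N \<Longrightarrow> e \<notin> N \<Longrightarrow> N = M"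
  shows "simple_omega_algebra K \<Omega> (image_alg R q op)"
proof -
  let ?B = "image_alg R q op"
  interpret B: assoc_omega_algebra K \<Omega> ?B by fact
  note ql = q_lin[of op]
  have M0: "\<zero>\<^bsub>R\<^esub> \<in> M" using submodule_zero_mem[OF module_R submodule_M] .
  have ker: "q x = \<zero>\<^bsub>?B\<^esub> \<longleftrightarrow> x \<in> M" if "x \<in> carrier R" for x
    using that q_eq_iff[of x "\<zero>\<^bsub>R\<^esub>"] by (simp add: image_alg_sel M.minus_equality[of "\<zero>\<^bsub>R\<^esub>" "\<zero>\<^bsub>R\<^esub>"])
  \<comment> \<open>The product of \<open>e\<close> with itself is \<open>e\<close>, which lies
    outside \<open>M\<close>.\<close>
  have "q e \<otimes>\<^bsub>?B\<^esub> q e \<noteq> \<zero>\<^bsub>?B\<^esub>"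
    using one ker by (simp add: image_alg_sel)
  hence "\<exists>x \<in> carrier ?B. \<exists>y \<in> carrier ?B. x \<otimes>\<^bsub>?B\<^esub> y \<noteq> \<zero>\<^bsub>?B\<^esub>"
    using lin_closed[OF ql one(1)] by blast
  moreover have "I = {\<zero>\<^bsub>?B\<^esub>} \<or> I = carrier ?B" if I: "omega_ideal K \<Omega> ?B I" for I
  proof -
    have sub: "submodule I K ?B" using I by (simp add: omega_ideal_def)
    have mult: "x \<otimes>\<^bsub>?B\<^esub> b \<in> I" "b \<otimes>\<^bsub>?B\<^esub> x \<in> I" if "b \<in> I" "x \<in> carrier ?B" for b x
      using I that by (auto simp: omega_ideal_def)
    note IE = B.submoduleE[OF sub] and qc = lin_closed[OF ql]
    have I0: "\<zero>\<^bsub>?B\<^esub> \<in> I" by (rule submodule_zero_mem[OF module_image_alg sub])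
    define N where "N = {r \<in> carrier R. q r \<in> I}"
    have "submodule N K R"
      unfolding N_def
      by (rule submoduleI)
        (use I0 IE in \<open>auto simp: lin_minus[OF module_R module_image_alg ql]
          lin_add[OF ql] lin_smult[OF ql] lin_zero[OF module_R module_image_alg ql]\<close>)
    moreover have "q (x \<otimes>\<^bsub>R\<^esub> a) \<in> I \<and> q (a \<otimes>\<^bsub>R\<^esub> x) \<in> I" if "a \<in> N" "x \<in> carrier R" for a x
      using mult[of "q a" "q x"] that qc[of x] by (auto simp: N_def image_alg_sel)
    ultimately have N: "omega_ideal K (\<lambda>_. {}) R N"
      by (auto simp: omega_ideal_def N_def mult_closed)
    have MN: "M \<subseteq> N" unfolding N_def
    proof
      fix m assume m: "m \<in> M"
      hence "m \<in> carrier R" using submoduleE(1)[OF submodule_M] by blast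
      thus "m \<in> {r \<in> carrier R. q r \<in> I}" using m ker[of m] I0 by (metis mem_Collect_eq)
    qed
    show ?thesis
    proof (cases "e \<in> N")
      case True
      \<comment> \<open>Since \<open>r\<close> equals \<open>r e\<close>, the element
        \<open>q r\<close> is a multiple of \<open>q e\<close>, which belongs to
        \<open>I\<close>.\<close>
      have "q r \<in> I" if r: "r \<in> carrier R" for r
        using mult(1)[of "q e" "q r"] qc[OF r] True r one by (simp add: N_def image_alg_sel)
      thus ?thesis using IE(1) by (auto simp: image_alg_sel)
    next
      case False
      have "b = \<zero>\<^bsub>?B\<^esub>" if b: "b \<in> I" for b
      proof -
        obtain r where r: "r \<in> carrier R" "b = q r" using b IE(1) by (auto simp: image_alg_sel)
        hence "r \<in> N" using b by (simp add: N_def)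
        thus ?thesis using max[OF N MN False] ker r by simp
      qed
      thus ?thesis using I0 by blast
    qed
  qed
  ultimately show ?thesis using alg by (simp add: simple_omega_algebra_def)
qed

end

section \<open>Extending operations along a linear retraction\<close>

text \<open>\<open>map g\<close> commutes with updating one entry, so linearity in each slot
  survives composition with linear maps. When \<open>g\<close> is a retraction of \<open>h\<close>,
  this extends \<open>f\<close> along \<open>h\<close>.\<close>

lemma multilinear_op_transport:
  assumes "multilinear_op K A n f" "h \<in> lin K A B" "g \<in> lin K B A" "module K B"
  shows "multilinear_op K B n (\<lambda>xs. h (f (map g xs)))"
proof -
  interpret B: module K B by fact
  have tup: "map g xs \<in> tuples A n" if "xs \<in> tuples B n" for xs
    using that lin_closed[OF assms(3)] by (auto simp: tuples_def)
  have upd: "ys[i := a] \<in> tuples A n" if "ys \<in> tuples A n" "a \<in> carrier A" for ys i a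
    using that set_update_subset_insert[of ys i a] by (auto simp: tuples_def)
  have f: "f ys \<in> carrier A" if "ys \<in> tuples A n" for ys
    using assms(1) that by (auto simp: multilinear_op_def)
  show ?thesis
    using assms(1) tup upd f lin_closed[OF assms(2)] lin_closed[OF assms(3)]
    by (auto simp: multilinear_op_def map_update lin_add[OF assms(2)] lin_add[OF assms(3)]
        lin_smult[OF assms(2)] lin_smult[OF assms(3)])
qed

text \<open>A coset is labelled by the code of a chosen representative, so the quotient fits into
  the type that already encodes \<open>R\<close>.\<close>

lemma quotient_encoding:
  assumes "module K R" and M: "submodule M K R" and enc: "inj_on enc (carrier R)"
  obtains q where "\<And>x y. x \<in> carrier R \<Longrightarrow> y \<in> carrier R \<Longrightarrow>
    enc (q x) = enc (q y) \<longleftrightarrow> x \<oplus>\<^bsub>R\<^esub> \<ominus>\<^bsub>R\<^esub> y \<in> M"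
proof -
  interpret R: module K R by fact
  note ME = R.submoduleE[OF M]
  define E where "E = (\<lambda>x y. y \<in> carrier R \<and> x \<oplus>\<^bsub>R\<^esub> \<ominus>\<^bsub>R\<^esub> y \<in> M)"
  define q where "q = (\<lambda>x. SOME y. E x y)"
  have refl: "E x x" if "x \<in> carrier R" for x
    using that submodule_zero_mem[OF assms(1,2)] by (simp add: E_def R.M.r_neg)
  have sym: "E y x" if "x \<in> carrier R" "E x y" for x y
    using that ME(3)[of "x \<oplus>\<^bsub>R\<^esub> \<ominus>\<^bsub>R\<^esub> y"] by (simp add: E_def R.M.minus_add R.M.a_comm)
  have trans: "E x z" if xyz: "x \<in> carrier R" "E x y" "E y z" for x y z
  proof -
    have c: "y \<in> carrier R" "z \<in> carrier R" using xyz by (auto simp: E_def)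
    have "(x \<oplus>\<^bsub>R\<^esub> \<ominus>\<^bsub>R\<^esub> y) \<oplus>\<^bsub>R\<^esub> (y \<oplus>\<^bsub>R\<^esub> \<ominus>\<^bsub>R\<^esub> z) \<in> M"
      using xyz(2,3) by (auto simp: E_def intro: ME(5)[of "x \<oplus>\<^bsub>R\<^esub> \<ominus>\<^bsub>R\<^esub> y"])
    moreover have "(x \<oplus>\<^bsub>R\<^esub> \<ominus>\<^bsub>R\<^esub> y) \<oplus>\<^bsub>R\<^esub> (y \<oplus>\<^bsub>R\<^esub> \<ominus>\<^bsub>R\<^esub> z) = x \<oplus>\<^bsub>R\<^esub> \<ominus>\<^bsub>R\<^esub> z"
      using xyz(1) c by (simp add: R.M.a_assoc R.M.r_neg1)
    ultimately show ?thesis using c by (simp add: E_def)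
  qed
  have Eq: "E x (q x)" if "x \<in> carrier R" for x
    unfolding q_def using refl[OF that] by (rule someI)
  have qc: "q x \<in> carrier R" if "x \<in> carrier R" for x using Eq[OF that] by (simp add: E_def)
  have "enc (q x) = enc (q y) \<longleftrightarrow> x \<oplus>\<^bsub>R\<^esub> \<ominus>\<^bsub>R\<^esub> y \<in> M" if xy: "x \<in> carrier R" "y \<in> carrier R" for x y
  proof
    assume "enc (q x) = enc (q y)"
    hence "q x = q y" using enc qc xy by (auto dest: inj_onD)
    hence "E x y" using Eq[OF xy(1)] Eq[OF xy(2)] sym trans xy by metis
    thus "x \<oplus>\<^bsub>R\<^esub> \<ominus>\<^bsub>R\<^esub> y \<in> M" by (simp add: E_def)
  next
    assume "x \<oplus>\<^bsub>R\<^esub> \<ominus>\<^bsub>R\<^esub> y \<in> M"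
    hence "E x y" using xy by (simp add: E_def)
    \<comment> \<open>Congruent elements have the same predicate, and \<open>SOME\<close> depends
      only on the predicate, so the chosen representatives coincide.\<close>
    hence "E x = E y" using sym trans xy by blast
    hence "q x = q y" by (simp add: q_def)
    thus "enc (q x) = enc (q y)" by simp
  qed
  thus thesis by (rule that)
qed

text \<open>By \<open>key\<close>, an ideal containing \<open>\<iota> a\<close> for a nonzero
  \<open>a\<close> contains the unit; so a maximal ideal without the unit contains no such element,
  and \<open>A\<close> embeds into the quotient. The map \<open>enc\<close> places the carrier in
  the type \<open>'b\<close>.\<close>

lemma embeds_in_simple_quotient:
  fixes A :: "('k, 'a, 'o, 'm) omega_alg_scheme" and R :: "('k, 'r, 'o, 'n) omega_alg_scheme"
    and enc :: "'r \<Rightarrow> 'b"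
  assumes "field K" and A: "assoc_omega_algebra K \<Omega> A"
    and R: "assoc_omega_algebra K (\<lambda>_. {}) R"
    and one: "\<one>\<^bsub>R\<^esub> \<in> carrier R" "\<one>\<^bsub>R\<^esub> \<noteq> \<zero>\<^bsub>R\<^esub>" "\<And>x. x \<in> carrier R \<Longrightarrow> x \<otimes>\<^bsub>R\<^esub> \<one>\<^bsub>R\<^esub> = x"
    and \<iota>: "\<iota> \<in> lin K A R"
      "\<And>a b. a \<in> carrier A \<Longrightarrow> b \<in> carrier A \<Longrightarrow> \<iota> (a \<otimes>\<^bsub>A\<^esub> b) = \<iota> a \<otimes>\<^bsub>R\<^esub> \<iota> b"
    and key: "\<And>a. a \<in> carrier A \<Longrightarrow> a \<noteq> \<zero>\<^bsub>A\<^esub> \<Longrightarrow>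
      \<exists>x \<in> carrier R. \<exists>y \<in> carrier R. x \<otimes>\<^bsub>R\<^esub> (\<iota> a \<otimes>\<^bsub>R\<^esub> y) = \<one>\<^bsub>R\<^esub>"
    and enc: "inj_on enc (carrier R)"
  shows "\<exists>(B :: ('k, 'b, 'o) omega_alg) h.
    simple_omega_algebra K \<Omega> B \<and> h \<in> omega_hom K \<Omega> A B \<and> inj_on h (carrier A)"
proof -
  interpret A: assoc_omega_algebra K \<Omega> A by fact
  interpret R: assoc_omega_algebra K "\<lambda>_. {}" R by fact
  have modA: "module K A" and modR: "module K R" by unfold_locales
  txt \<open>An ideal of \<open>R\<close> is proper iff it meets the scalars trivially, so a maximal ideal with this property is
    a maximal ideal.\<close>
  define U where "U = {c \<odot>\<^bsub>R\<^esub> \<one>\<^bsub>R\<^esub> | c. c \<in> carrier K}"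
  \<comment> \<open>For a submodule, stability under \<open>T\<close> means being a two-sided
    ideal.\<close>
  define T where "T = {\<lambda>y. x \<otimes>\<^bsub>R\<^esub> y | x. x \<in> carrier R} \<union> {\<lambda>y. y \<otimes>\<^bsub>R\<^esub> x | x. x \<in> carrier R}"
  have "\<zero>\<^bsub>R\<^esub> = \<zero>\<^bsub>K\<^esub> \<odot>\<^bsub>R\<^esub> \<one>\<^bsub>R\<^esub>" using one(1) by simp
  hence U0: "\<zero>\<^bsub>R\<^esub> \<in> U" unfolding U_def by blast
  have "\<one>\<^bsub>R\<^esub> = \<one>\<^bsub>K\<^esub> \<odot>\<^bsub>R\<^esub> \<one>\<^bsub>R\<^esub>" using one(1) by simp
  hence U1: "\<one>\<^bsub>R\<^esub> \<in> U" unfolding U_def by blast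
  have ml: "(\<lambda>y. x \<otimes>\<^bsub>R\<^esub> y) \<in> lin K R R" and mr: "(\<lambda>y. y \<otimes>\<^bsub>R\<^esub> x) \<in> lin K R R"
    if "x \<in> carrier R" for x
    by (rule linI; simp add: that R.mult_closed R.distr_left R.distr_right R.smult_mult_left
        R.smult_mult_right)+
  have T0: "t \<zero>\<^bsub>R\<^esub> = \<zero>\<^bsub>R\<^esub>" if "t \<in> T" for t
    using that lin_zero[OF modR modR ml] lin_zero[OF modR modR mr] unfolding T_def by blast
  obtain M where M: "submodule M K R" "\<And>t x. t \<in> T \<Longrightarrow> x \<in> M \<Longrightarrow> t x \<in> M" "M \<inter> U = {\<zero>\<^bsub>R\<^esub>}"
    and max: "\<And>N'. submodule N' K R \<Longrightarrow> (\<And>t x. t \<in> T \<Longrightarrow> x \<in> N' \<Longrightarrow> t x \<in> N') \<Longrightarrow>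
      M \<subseteq> N' \<Longrightarrow> N' \<inter> U = {\<zero>\<^bsub>R\<^esub>} \<Longrightarrow> N' = M"
    using maximal_submodule_avoiding[OF modR U0, of T] T0 by blast
  have M_ideal: "omega_ideal K (\<lambda>_. {}) R M"
    using M(1,2) unfolding omega_ideal_def T_def by blast
  have 1: "\<one>\<^bsub>R\<^esub> \<notin> M" using M(3) U1 one(2) by blast
  have maxM: "N = M" if N: "omega_ideal K (\<lambda>_. {}) R N" "M \<subseteq> N" "\<one>\<^bsub>R\<^esub> \<notin> N" for N
  proof (rule max)
    show sub: "submodule N K R" using N(1) by (simp add: omega_ideal_def)
    show "t x \<in> N" if "t \<in> T" "x \<in> N" for t x
      using N(1) that unfolding T_def omega_ideal_def by blast
    show "M \<subseteq> N" by fact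
    \<comment> \<open>A nonzero multiple of the unit lying in \<open>N\<close> could be divided by
      its scalar, which would put the unit itself into \<open>N\<close>.\<close>
    have "x = \<zero>\<^bsub>R\<^esub>" if x: "x \<in> N" "x \<in> U" for x
    proof (rule ccontr)
      assume "x \<noteq> \<zero>\<^bsub>R\<^esub>"
      obtain c where c: "c \<in> carrier K" "x = c \<odot>\<^bsub>R\<^esub> \<one>\<^bsub>R\<^esub>" using x(2) unfolding U_def by blast
      hence "c \<noteq> \<zero>\<^bsub>K\<^esub>" using \<open>x \<noteq> \<zero>\<^bsub>R\<^esub>\<close> one(1) by auto
      hence ic: "inv\<^bsub>K\<^esub> c \<in> carrier K" "inv\<^bsub>K\<^esub> c \<otimes>\<^bsub>K\<^esub> c = \<one>\<^bsub>K\<^esub>"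
        using c(1) A.K.field_Units by auto
      have "inv\<^bsub>K\<^esub> c \<odot>\<^bsub>R\<^esub> x = \<one>\<^bsub>R\<^esub>" using ic c one(1) by (simp add: R.smult_assoc1[symmetric])
      thus False using R.submoduleE(4)[OF sub ic(1) x(1)] N(3) by simp
    qed
    thus "N \<inter> U = {\<zero>\<^bsub>R\<^esub>}" using U0 submodule_zero_mem[OF modR sub] by blast
  qed
  obtain q0 where q0: "\<And>x y. x \<in> carrier R \<Longrightarrow> y \<in> carrier R \<Longrightarrow>
      enc (q0 x) = enc (q0 y) \<longleftrightarrow> x \<oplus>\<^bsub>R\<^esub> \<ominus>\<^bsub>R\<^esub> y \<in> M"
    using quotient_encoding[OF modR M(1) enc] by blast
  define q where "q = enc \<circ> q0"
  interpret Q: algebra_quotient K R M q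
    by unfold_locales (use M_ideal q0 in \<open>auto simp: q_def\<close>)
  define h where "h = q \<circ> \<iota>"
  \<comment> \<open>The operations stay a parameter: their definition needs a retraction
    \<open>g\<close>, which is first obtained from the linear structure of the quotient.\<close>
  define B :: "('o \<Rightarrow> 'b list \<Rightarrow> 'b) \<Rightarrow> ('k, 'b, 'o) omega_alg" where "B = image_alg R q"
  have modB: "module K (B op)" for op unfolding B_def by (rule Q.module_image_alg)
  have h: "h \<in> lin K A (B op)" for op
    unfolding h_def B_def by (rule lin_comp[OF \<iota>(1) Q.q_lin])
  have h_inj: "inj_on h (carrier A)"
  proof (rule lin_inj_onI[OF modA modB h])
    fix a assume a: "a \<in> carrier A" and ha: "h a = \<zero>\<^bsub>B undefined\<^esub>"
    have \<iota>a: "\<iota> a \<in> carrier R" using lin_closed[OF \<iota>(1) a] .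
    have "\<iota> a \<in> M"
      using ha Q.q_eq_iff[OF \<iota>a R.M.zero_closed] \<iota>a R.M.minus_equality[of "\<zero>\<^bsub>R\<^esub>" "\<zero>\<^bsub>R\<^esub>"]
      by (simp add: h_def B_def Q.image_alg_sel)
    show "a = \<zero>\<^bsub>A\<^esub>"
    proof (rule ccontr)
      assume "a \<noteq> \<zero>\<^bsub>A\<^esub>"
      then obtain x y where "x \<in> carrier R" "y \<in> carrier R" "x \<otimes>\<^bsub>R\<^esub> (\<iota> a \<otimes>\<^bsub>R\<^esub> y) = \<one>\<^bsub>R\<^esub>"
        using key[OF a] by blast
      \<comment> \<open>Absorption keeps \<open>x (\<iota> a y)\<close> in \<open>M\<close>, so the
        unit would lie in \<open>M\<close>.\<close>
      thus False using 1 \<open>\<iota> a \<in> M\<close> Q.ideal_mult by metis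
    qed
  qed
  obtain g where g: "g \<in> lin K (B undefined) A" "\<And>a. a \<in> carrier A \<Longrightarrow> g (h a) = a"
    using lin_left_inverse[OF assms(1) modA modB h h_inj] by blast
  txt \<open>Since \<open>g\<close> is a linear retraction of \<open>h\<close>, these operations extend those of \<open>A\<close>.\<close>
  define op where "op = (\<lambda>\<delta> xs. h (oper A \<delta> (map g xs)))"
  \<comment> \<open>The linear structure of \<open>B op\<close> is the same for every
    \<open>op\<close>.\<close>
  have g': "g \<in> lin K (B op) A"
    using g(1) by (simp add: lin_def B_def image_alg_def Let_def)
  have "multilinear_op K (B op) n (op \<delta>)" if "1 \<le> n" "\<delta> \<in> \<Omega> n" for n \<delta>
    using multilinear_op_transport[OF A.oper_multilinear[OF that] h g' modB] by (simp only: op_def)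
  hence alg: "assoc_omega_algebra K \<Omega> (B op)"
    unfolding B_def by (rule Q.image_alg_algebra)
  have "simple_omega_algebra K \<Omega> (B op)"
    using Q.image_alg_simple[of \<Omega> op, OF _ one(1,3) 1 maxM] alg unfolding B_def by blast
  moreover have "h \<in> omega_hom K \<Omega> A (B op)"
  proof -
    have "h (a \<otimes>\<^bsub>A\<^esub> b) = h a \<otimes>\<^bsub>B op\<^esub> h b" if "a \<in> carrier A" "b \<in> carrier A" for a b
      using that lin_closed[OF \<iota>(1)] by (simp add: h_def B_def Q.image_alg_sel \<iota>(2))
    moreover have "h (oper A \<delta> xs) = oper (B op) \<delta> (map h xs)" if "xs \<in> tuples A n" for \<delta> xs n
    proof -
      \<comment> \<open>As \<open>g\<close> undoes \<open>h\<close>, the arguments passed to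
        \<open>oper A \<delta>\<close> are the original ones.\<close>
      have "map (g \<circ> h) xs = xs" using that g(2) by (intro map_idI) (auto simp: tuples_def)
      thus ?thesis by (simp add: B_def Q.image_alg_sel op_def)
    qed
    ultimately show ?thesis using h[of op] by (auto simp: omega_hom_def lin_def)
  qed
  ultimately show ?thesis using h_inj by blast
qed

section \<open>The embedding\<close>

definition unitization_module ::
  "('k, 'l) ring_scheme \<Rightarrow> ('k, 'a, 'm) module_scheme \<Rightarrow> ('k, 'k \<times> 'a) module" where
  "unitization_module K A = \<lparr>carrier = carrier K \<times> carrier A, monoid.mult = undefined, one = undefined,
     ring.zero = (\<zero>\<^bsub>K\<^esub>, \<zero>\<^bsub>A\<^esub>), add = (\<lambda>x y. (fst x \<oplus>\<^bsub>K\<^esub> fst y, snd x \<oplus>\<^bsub>A\<^esub> snd y)),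
     smult = (\<lambda>c x. (c \<otimes>\<^bsub>K\<^esub> fst x, c \<odot>\<^bsub>A\<^esub> snd x))\<rparr>"

lemma unitization_module_sel [simp]:
  "carrier (unitization_module K A) = carrier K \<times> carrier A"
  "\<zero>\<^bsub>unitization_module K A\<^esub> = (\<zero>\<^bsub>K\<^esub>, \<zero>\<^bsub>A\<^esub>)"
  "x \<oplus>\<^bsub>unitization_module K A\<^esub> y = (fst x \<oplus>\<^bsub>K\<^esub> fst y, snd x \<oplus>\<^bsub>A\<^esub> snd y)"
  "c \<odot>\<^bsub>unitization_module K A\<^esub> x = (c \<otimes>\<^bsub>K\<^esub> fst x, c \<odot>\<^bsub>A\<^esub> snd x)"
  by (simp_all add: unitization_module_def)

lemma module_unitization: assumes "module K A" shows "module K (unitization_module K A)"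
proof -
  interpret A: module K A by fact
  show ?thesis
  proof (intro moduleI abelian_groupI A.R.is_cring)
    fix x assume "x \<in> carrier (unitization_module K A)"
    thus "\<exists>y \<in> carrier (unitization_module K A).
        y \<oplus>\<^bsub>unitization_module K A\<^esub> x = \<zero>\<^bsub>unitization_module K A\<^esub>"
      by (intro bexI[of _ "(\<ominus>\<^bsub>K\<^esub> fst x, \<ominus>\<^bsub>A\<^esub> snd x)"]) (auto simp: A.R.l_neg A.M.l_neg)
  qed (auto simp: A.R.a_ac A.M.a_ac A.R.l_distr A.R.r_distr A.R.m_assoc
      A.smult_l_distr A.smult_r_distr A.smult_assoc1)
qed

text \<open>Left multiplication by \<open>(0, a)\<close> in the unitization. It sends
  \<open>(1, 0)\<close> to \<open>(0, a)\<close>, so the action is faithful even if all products in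
  \<open>A\<close> vanish.\<close>

definition mult_unitization ::
  "('k, 'a, 'm) module_scheme \<Rightarrow> ('k, 'l) ring_scheme \<Rightarrow> 'a \<Rightarrow> 'k \<times> 'a \<Rightarrow> 'k \<times> 'a" where
  "mult_unitization A K a x = (\<zero>\<^bsub>K\<^esub>, fst x \<odot>\<^bsub>A\<^esub> a \<oplus>\<^bsub>A\<^esub> a \<otimes>\<^bsub>A\<^esub> snd x)"

theorem theorem6p2:
  fixes K :: "('k, 'l) ring_scheme"
    and \<Omega> :: "nat \<Rightarrow> 'o set"
    and A :: "('k, 'a, 'o, 'm) omega_alg_scheme"
  assumes "field K"
    and "assoc_omega_algebra K \<Omega> A"
  shows "\<exists>(B :: ('k, ('k, 'a, 'o) ambient, 'o) omega_alg) h.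
           simple_omega_algebra K \<Omega> B \<and> h \<in> omega_hom K \<Omega> A B \<and> inj_on h (carrier A)"
proof -
  interpret A: assoc_omega_algebra K \<Omega> A by fact
  have modA: "module K A" by unfold_locales
  let ?W = "unitization_module K A" and ?act = "mult_unitization A K"
  have W: "module K ?W" by (rule module_unitization[OF modA])
  \<comment> \<open>The indices are words over the ambient alphabet; prefixing the two letters that
    spell \<open>w\<close> gives an index from which \<open>i\<close> and \<open>w\<close> can be
    recovered.\<close>
  define e :: "('a + 'k + 'o + nat) list \<Rightarrow> 'k \<times> 'a \<Rightarrow> ('a + 'k + 'o + nat) list" where
    "e = (\<lambda>i w. Inr (Inl (fst w)) # Inl (snd w) # i)"
  have e: "i = i' \<and> w = w'" if "e i w = e i' w'" for i w i' w'
    using that by (auto simp: e_def prod_eq_iff)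
  txt \<open>The length of \<open>i\<close> is recorded so that \<open>i @ j\<close> can be split again.\<close>
  define code :: "('a + 'k + 'o + nat) list \<times> ('k \<times> 'a) \<times> ('a + 'k + 'o + nat) list \<times> ('k \<times> 'a) \<Rightarrow>
      ('a + 'k + 'o + nat) list" where
    "code = (\<lambda>(i, v, j, w). Inr (Inr (Inr (length i))) # e (e (i @ j) v) w)"
  have code: "inj code"
    by (rule injI) (auto simp: code_def e_def prod_eq_iff)
  let ?V = "fsfun ?W :: ('k, ('a + 'k + 'o + nat) list \<Rightarrow> 'k \<times> 'a) module"
  let ?E = "endo K ?V :: ('k, (('a + 'k + 'o + nat) list \<Rightarrow> 'k \<times> 'a) \<Rightarrow> _, 'o) omega_alg"
  have "\<exists>\<iota> \<in> lin K A ?E.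
    (\<forall>a \<in> carrier A. \<forall>b \<in> carrier A. \<iota> (a \<otimes>\<^bsub>A\<^esub> b) = \<iota> a \<otimes>\<^bsub>?E\<^esub> \<iota> b) \<and>
    (\<forall>a \<in> carrier A. a \<noteq> \<zero>\<^bsub>A\<^esub> \<longrightarrow>
      (\<exists>x \<in> carrier ?E. \<exists>y \<in> carrier ?E. x \<otimes>\<^bsub>?E\<^esub> (\<iota> a \<otimes>\<^bsub>?E\<^esub> y) = \<one>\<^bsub>?E\<^esub>))"
  proof (rule diagonal_action[OF assms(1) W modA, where act = ?act and u = "(\<one>\<^bsub>K\<^esub>, \<zero>\<^bsub>A\<^esub>)" and e = e])
    \<comment> \<open>Derived from compatibility with the zero scalar: moving it out of the second
      factor turns the product into zero.\<close>
    have z: "a \<otimes>\<^bsub>A\<^esub> \<zero>\<^bsub>A\<^esub> = \<zero>\<^bsub>A\<^esub>" if "a \<in> carrier A" for a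
      using that A.smult_mult_right[of "\<zero>\<^bsub>K\<^esub>" a "\<zero>\<^bsub>A\<^esub>"] A.mult_closed by simp
    show "?act a \<in> lin K ?W ?W" if "a \<in> carrier A" for a
      by (rule linI)
        (use that in \<open>auto simp: mult_unitization_def A.mult_closed A.distr_right A.smult_mult_right
          A.smult_l_distr A.smult_r_distr A.smult_assoc1 A.M.a_ac\<close>)
    show "?act (a \<oplus>\<^bsub>A\<^esub> b) w = ?act a w \<oplus>\<^bsub>?W\<^esub> ?act b w"
      if "a \<in> carrier A" "b \<in> carrier A" "w \<in> carrier ?W" for a b w
      using that by (auto simp: mult_unitization_def A.mult_closed A.distr_left A.smult_r_distr A.M.a_ac)
    show "?act (c \<odot>\<^bsub>A\<^esub> a) w = c \<odot>\<^bsub>?W\<^esub> ?act a w"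
      if "c \<in> carrier K" "a \<in> carrier A" "w \<in> carrier ?W" for c a w
      using that by (auto simp: mult_unitization_def A.mult_closed A.smult_mult_left A.smult_r_distr
          A.smult_assoc1[symmetric] A.K.m_comm)
    show "?act (a \<otimes>\<^bsub>A\<^esub> b) w = ?act a (?act b w)"
      if "a \<in> carrier A" "b \<in> carrier A" "w \<in> carrier ?W" for a b w
      using that by (auto simp: mult_unitization_def A.mult_closed A.mult_assoc A.distr_right
          A.smult_mult_right)
    show "a = \<zero>\<^bsub>A\<^esub>" if "a \<in> carrier A" "?act a (\<one>\<^bsub>K\<^esub>, \<zero>\<^bsub>A\<^esub>) = \<zero>\<^bsub>?W\<^esub>" for a
      using that z by (simp add: mult_unitization_def)
    show "i = i' \<and> w = w'" if "e i w = e i' w'" for i w i' w' using e that .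
  qed simp
  then obtain \<iota> where \<iota>: "\<iota> \<in> lin K A ?E"
    "\<And>a b. a \<in> carrier A \<Longrightarrow> b \<in> carrier A \<Longrightarrow> \<iota> (a \<otimes>\<^bsub>A\<^esub> b) = \<iota> a \<otimes>\<^bsub>?E\<^esub> \<iota> b"
    "\<And>a. a \<in> carrier A \<Longrightarrow> a \<noteq> \<zero>\<^bsub>A\<^esub> \<Longrightarrow>
      \<exists>x \<in> carrier ?E. \<exists>y \<in> carrier ?E. x \<otimes>\<^bsub>?E\<^esub> (\<iota> a \<otimes>\<^bsub>?E\<^esub> y) = \<one>\<^bsub>?E\<^esub>"
    by blast
  obtain enc :: "((('a + 'k + 'o + nat) list \<Rightarrow> 'k \<times> 'a) \<Rightarrow> ('a + 'k + 'o + nat) list \<Rightarrow> 'k \<times> 'a) \<Rightarrow>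
      ('k, 'a, 'o) ambient" where enc: "inj_on enc (carrier ?E)"
    using endo_encoding[OF W code] by blast
  have V: "module K ?V"
    by (rule module_fsfun[OF W])
  interpret V: module K ?V by fact
  have "(\<lambda>x. x) \<in> lin K ?V ?V"
    by (rule linI) auto
  from extend_zero_endo[OF V this] have one: "\<one>\<^bsub>?E\<^esub> \<in> carrier ?E"
    by (simp add: extend_zero_def)
  \<comment> \<open>The scalar component makes \<open>?V\<close> nonzero even if \<open>A\<close> is
    zero, so the unit of the endomorphism algebra differs from zero.\<close>
  have "single ?W [] (\<one>\<^bsub>K\<^esub>, \<zero>\<^bsub>A\<^esub>) \<in> carrier ?V"
    by (rule single_closed[OF W]) simp
  moreover have "single ?W [] (\<one>\<^bsub>K\<^esub>, \<zero>\<^bsub>A\<^esub>) [] \<noteq> \<zero>\<^bsub>?W\<^esub>" by (simp add: single_def)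
  ultimately have "\<one>\<^bsub>?E\<^esub> \<noteq> \<zero>\<^bsub>?E\<^esub>" by (auto simp: fun_eq_iff)
  moreover have "x \<otimes>\<^bsub>?E\<^esub> \<one>\<^bsub>?E\<^esub> = x" if "x \<in> carrier ?E" for x
    using that lin_zero[OF V V] by (auto simp: endo_carrier fun_eq_iff)
  ultimately show ?thesis
    using embeds_in_simple_quotient[OF assms endo_algebra[OF assms(1) V] one _ _ \<iota> enc] by blast
qed

end
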